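(* Let $d\ge 1$, $n\ge 2$, $N=\binom n2$ and $D=\binom{d+2}{2}$. Let ${\bf E}$ be a $D\times N$ complex matrix of rank $r$. If the image ${\bf E}(L_{d,n})$ (a constructible set) does not have dimension $r$, then $r=D$ and ${\bf E}$ has $K_{d+2}$ support, i.e., there is a set $U$ of $d+2$ vertices such that every column of ${\bf E}$ indexed by an edge not contained in $U$ is zero.
   Context: Index coordinates of $\mathbb C^N$ (and columns of ${\bf E}$) by the edges $\{i,j\}$ of $K_n$. For a complex configuration ${\bf p}=({\bf p}_1,\dots,{\bf p}_n)$ in $\mathbb C^d$, $m({\bf p})\in\mathbb C^N$ has coordinates $m_{ij}({\bf p})=\sum_{k=1}^d({\bf p}_i^k-{\bf p}_j^k)^2$ (no conjugation); $M_{d,n}$ is the image of $m$ over all complex configurations. With $s$ the coordinatewise squaring map on $\mathbb C^N$, $L_{d,n}=s^{-1}(M_{d,n})$. *)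

theory Defs
  imports Complex_Main "HOL-Library.Extended_Nat"
begin

definition cspace :: "'i set \<Rightarrow> ('i \<Rightarrow> complex) set" where
  "cspace I = {x. \<forall>i. i \<notin> I \<longrightarrow> x i = 0}"

inductive_set polyfun :: "'i set \<Rightarrow> (('i \<Rightarrow> complex) \<Rightarrow> complex) set" for I where
  pconst: "(\<lambda>x. c) \<in> polyfun I"
| pvar: "i \<in> I \<Longrightarrow> (\<lambda>x. x i) \<in> polyfun I"
| padd: "f \<in> polyfun I \<Longrightarrow> g \<in> polyfun I \<Longrightarrow> (\<lambda>x. f x + g x) \<in> polyfun I"
| pmult: "f \<in> polyfun I \<Longrightarrow> g \<in> polyfun I \<Longrightarrow> (\<lambda>x. f x * g x) \<in> polyfun I"

definition zariski_closed :: "'i set \<Rightarrow> ('i \<Rightarrow> complex) set \<Rightarrow> bool" where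
  "zariski_closed I S \<longleftrightarrow> (\<exists>P \<subseteq> polyfun I. S = {x \<in> cspace I. \<forall>f\<in>P. f x = 0})"

definition zariski_closure :: "'i set \<Rightarrow> ('i \<Rightarrow> complex) set \<Rightarrow> ('i \<Rightarrow> complex) set" where
  "zariski_closure I S = \<Inter>{T. zariski_closed I T \<and> S \<subseteq> T}"

definition zariski_irreducible :: "'i set \<Rightarrow> ('i \<Rightarrow> complex) set \<Rightarrow> bool" where
  "zariski_irreducible I T \<longleftrightarrow> zariski_closed I T \<and> T \<noteq> {} \<and>
     (\<forall>A B. zariski_closed I A \<and> zariski_closed I B \<and> T = A \<union> B \<longrightarrow> T = A \<or> T = B)"

definition alg_dim :: "'i set \<Rightarrow> ('i \<Rightarrow> complex) set \<Rightarrow> enat" where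
  "alg_dim I S = Sup {enat k | k. \<exists>T :: nat \<Rightarrow> ('i \<Rightarrow> complex) set.
      (\<forall>j\<le>k. zariski_irreducible I (T j) \<and> T j \<subseteq> zariski_closure I S) \<and>
      (\<forall>j<k. T j \<subset> T (Suc j))}"

definition Kedges :: "nat \<Rightarrow> nat set set" where
  "Kedges n = {{i, j} | i j. i < j \<and> j < n}"

text \<open>Configurations: p i k is the k-th coordinate (k < d) of the point p_i (i < n).
The measurement map m (no complex conjugation).\<close>
definition meas :: "nat \<Rightarrow> nat \<Rightarrow> (nat \<Rightarrow> nat \<Rightarrow> complex) \<Rightarrow> (nat set \<Rightarrow> complex)" where
  "meas d n p = (\<lambda>e. if e \<in> Kedges n
      then (\<Sum>k<d. (p (Min e) k - p (Max e) k)\<^sup>2) else 0)"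

definition Mdn :: "nat \<Rightarrow> nat \<Rightarrow> (nat set \<Rightarrow> complex) set" where
  "Mdn d n = range (meas d n)"

definition Ldn :: "nat \<Rightarrow> nat \<Rightarrow> (nat set \<Rightarrow> complex) set" where
  "Ldn d n = {x \<in> cspace (Kedges n). (\<lambda>e. (x e)\<^sup>2) \<in> Mdn d n}"

definition mat_apply :: "nat \<Rightarrow> nat \<Rightarrow> (nat \<Rightarrow> nat set \<Rightarrow> complex) \<Rightarrow> (nat set \<Rightarrow> complex) \<Rightarrow> (nat \<Rightarrow> complex)" where
  "mat_apply D n E x = (\<lambda>i. if i < D then (\<Sum>e\<in>Kedges n. E i e * x e) else 0)"

definition cols_independent :: "nat \<Rightarrow> (nat \<Rightarrow> nat set \<Rightarrow> complex) \<Rightarrow> nat set set \<Rightarrow> bool" where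
  "cols_independent D E C \<longleftrightarrow>
     (\<forall>c. (\<forall>i<D. (\<Sum>e\<in>C. c e * E i e) = 0) \<longrightarrow> (\<forall>e\<in>C. c e = 0))"

definition mat_rank :: "nat \<Rightarrow> nat \<Rightarrow> (nat \<Rightarrow> nat set \<Rightarrow> complex) \<Rightarrow> nat" where
  "mat_rank D n E = Max {card C | C. C \<subseteq> Kedges n \<and> cols_independent D E C}"

definition has_K_support :: "nat \<Rightarrow> nat \<Rightarrow> nat \<Rightarrow> (nat \<Rightarrow> nat set \<Rightarrow> complex) \<Rightarrow> bool" where
  "has_K_support k D n E \<longleftrightarrow> (\<exists>U \<subseteq> {..<n}. card U = k \<and>
     (\<forall>e\<in>Kedges n. \<not> e \<subseteq> U \<longrightarrow> (\<forall>i<D. E i e = 0)))"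

end

theory Submission
  imports Defs "HOL-Analysis.Analysis"
begin

text \<open>
  Let \<open>C\<close> be a basis of columns of \<open>E\<close>, so that \<open>card C = r \<le> D\<close>. Differentiating
  \<open>l\<^sub>e\<^sup>2 = m\<^sub>e(p)\<close>, the restriction of \<open>E\<close> to the variety of lengths fails to be a submersion onto the
  column space at \<open>l\<close> iff some nonzero \<open>w\<close> in the row space makes \<open>w\<^sub>e / l\<^sub>e\<close> an equilibrium stress
  of \<open>p\<close>. Suppose that \<open>C\<close> carries no nonzero stress of \<open>p\<close>. Each of the remaining columns
  contributes a rank-one term whose sign is that of \<open>l\<^sub>e\<close>, and the variety is invariant under sign
  changes; one of the two signs always preserves injectivity, so \<open>E\<close> is a submersion at some point.
  A polynomial vanishing on the image then has all its derivatives vanishing there, hence is zero on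
  the column space, and the image has dimension \<open>r\<close>.

  Take \<open>p\<close> on the moment curve. The support of a nonzero stress has minimum degree at least
  \<open>d + 1\<close>, hence at least \<open>D\<close> edges, with equality only for a complete graph on \<open>d + 2\<close> vertices.
  So if the dimension is not \<open>r\<close>, every column basis is the edge set of such a graph. Two of these
  never differ by a single exchange, so there is only one basis and all other columns are zero.
\<close>

section \<open>Linear independence of families of functions\<close>

text \<open>One notion for several families: columns of a matrix (\<open>\<Omega>\<close> the row
  indices), polynomial functions on a variety, and differentials of edge lengths
  (\<open>\<Omega>\<close> all directions of motion).\<close>

definition indep_on :: "'a set \<Rightarrow> 's set \<Rightarrow> ('a \<Rightarrow> 's \<Rightarrow> complex) \<Rightarrow> bool" where
  "indep_on C \<Omega> F \<longleftrightarrow>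
     (\<forall>w. (\<forall>s\<in>\<Omega>. (\<Sum>a\<in>C. w a * F a s) = 0) \<longrightarrow> (\<forall>a\<in>C. w a = 0))"

lemma indep_onD:
  "\<lbrakk>indep_on C \<Omega> F; \<And>s. s \<in> \<Omega> \<Longrightarrow> (\<Sum>a\<in>C. w a * F a s) = 0; a \<in> C\<rbrakk> \<Longrightarrow> w a = 0"
  unfolding indep_on_def by blast

lemma indep_on_subset:
  assumes "indep_on C \<Omega> F" "C' \<subseteq> C" "finite C"
  shows "indep_on C' \<Omega> F"
  unfolding indep_on_def
proof (intro allI impI ballI)
  fix w a assume w: "\<forall>s\<in>\<Omega>. (\<Sum>a\<in>C'. w a * F a s) = 0" and a: "a \<in> C'"
  have "(\<Sum>a\<in>C. (if a \<in> C' then w a else 0) * F a s) = (\<Sum>a\<in>C'. w a * F a s)" for s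
    using assms by (intro sum.mono_neutral_cong_right) auto
  then show "w a = 0"
    using w a assms(2) indep_onD[OF assms(1), of "\<lambda>a. if a \<in> C' then w a else 0" a] by auto
qed

text \<open>Gaussian elimination, one coordinate of \<open>B\<close> at a time: a vector that is
  nonzero at \<open>b\<close> serves as pivot and clears that coordinate from the others.\<close>

lemma not_indep_on_if_card_less:
  fixes F :: "'a \<Rightarrow> 's \<Rightarrow> complex"
  assumes "finite B" "finite A" "card B < card A"
  shows "\<not> indep_on A B F"
  using assms
proof (induction B arbitrary: A F rule: finite_induct)
  case empty
  then have "A \<noteq> {}" by auto
  then show ?case unfolding indep_on_def by (auto intro!: exI[of _ "\<lambda>_. 1"])
next
  case (insert b B)
  show ?case
  proof (cases "\<forall>a\<in>A. F a b = 0")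
    case True
    have "\<not> indep_on A B F" using insert by auto
    then show ?thesis using True unfolding indep_on_def by auto
  next
    case False
    then obtain a0 where a0: "a0 \<in> A" "F a0 b \<noteq> 0" by auto
    define F' where "F' a s = F a s - F a b / F a0 b * F a0 s" for a s
    have "\<not> indep_on (A - {a0}) B F'"
      using insert.prems insert.hyps a0 by (intro insert.IH) auto
    then obtain w a1 where w: "\<And>s. s \<in> B \<Longrightarrow> (\<Sum>a\<in>A - {a0}. w a * F' a s) = 0"
      and a1: "a1 \<in> A - {a0}" "w a1 \<noteq> 0"
      unfolding indep_on_def by blast
    \<comment> \<open>The pivot's coefficient collects what the elimination subtracted from the
      other vectors.\<close>
    define w0 where "w0 = - (\<Sum>a\<in>A - {a0}. w a * F a b / F a0 b)"
    define w' where "w' = w(a0 := w0)"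
    have split: "(\<Sum>a\<in>A. w' a * F a s) = (\<Sum>a\<in>A - {a0}. w a * F' a s)" for s
    proof -
      have "(\<Sum>a\<in>A. w' a * F a s) = w0 * F a0 s + (\<Sum>a\<in>A - {a0}. w a * F a s)"
        using a0 insert.prems by (simp add: sum.remove[of A a0] w'_def)
      also have "\<dots> = (\<Sum>a\<in>A - {a0}. w a * F' a s)"
        by (simp add: w0_def F'_def algebra_simps sum_subtractf sum_distrib_left sum_distrib_right)
      finally show ?thesis .
    qed
    have "(\<Sum>a\<in>A. w' a * F a s) = 0" if "s \<in> insert b B" for s
      using that w a0 by (auto simp: split F'_def)
    moreover have "a1 \<in> A" "w' a1 \<noteq> 0" using a1 by (auto simp: w'_def)
    ultimately show ?thesis unfolding indep_on_def by blast
  qed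
qed

text \<open>A dual family exists already among finite combinations of point evaluations. It is built
  one vector at a time, as in Gram-Schmidt.\<close>

lemma indep_on_dual:
  fixes F :: "'a \<Rightarrow> 's \<Rightarrow> complex"
  assumes "finite C" "indep_on C \<Omega> F"
  shows "\<exists>S b. finite S \<and> S \<subseteq> \<Omega> \<and>
    (\<forall>c\<in>C. \<forall>c'\<in>C. (\<Sum>s\<in>S. b c s * F c' s) = (if c = c' then 1 else 0))"
  using assms
proof (induction C rule: finite_induct)
  case empty
  show ?case by (intro exI[of _ "{}"]) auto
next
  case (insert c0 C)
  have "indep_on C \<Omega> F"
    using insert.hyps by (intro indep_on_subset[OF insert.prems]) auto
  from insert.IH[OF this] obtain S b where Sb: "finite S \<and> S \<subseteq> \<Omega> \<and>
    (\<forall>c\<in>C. \<forall>c'\<in>C. (\<Sum>s\<in>S. b c s * F c' s) = (if c = c' then 1 else 0))"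
    by metis
  note S = conjunct1[OF Sb] conjunct1[OF conjunct2[OF Sb]]
  note b = conjunct2[OF conjunct2[OF Sb], rule_format]
  define \<beta> where "\<beta> c = (\<Sum>s\<in>S. b c s * F c0 s)" for c
  define w where "w c = (if c = c0 then 1 else - \<beta> c)" for c
  \<comment> \<open>The part of \<open>F c0\<close> left after removing its components
    \<open>\<beta> c\<close> along the old family is nonzero by independence, so some point
    \<open>t\<close> detects it; \<open>\<alpha>\<close> is its value there.\<close>
  have "\<exists>t\<in>\<Omega>. (\<Sum>c\<in>insert c0 C. w c * F c t) \<noteq> 0"
  proof (rule ccontr)
    assume "\<not> ?thesis"
    then show False using indep_onD[OF insert.prems, of w c0] by (auto simp: w_def)
  qed
  then obtain t where t: "t \<in> \<Omega>" "(\<Sum>c\<in>insert c0 C. w c * F c t) \<noteq> 0" by blast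
  define \<alpha> where "\<alpha> = (\<Sum>c\<in>insert c0 C. w c * F c t)"
  have wC: "w c = - \<beta> c" if "c \<in> C" for c
    using that insert.hyps by (auto simp: w_def)
  have \<alpha>: "\<alpha> \<noteq> 0" "\<alpha> = F c0 t - (\<Sum>c\<in>C. \<beta> c * F c t)"
    using t insert.hyps by (auto simp: \<alpha>_def wC sum_negf) (simp add: w_def)
  define S' where "S' = insert t S"
  define b1 where "b1 c s = (if s \<in> S then b c s else 0)" for c s
  have fS': "finite S'" "S' \<subseteq> \<Omega>" using S t by (auto simp: S'_def)
  have b1: "(\<Sum>s\<in>S'. b1 c s * F c' s) = (\<Sum>s\<in>S. b c s * F c' s)" for c c'
    using S fS' by (intro sum.mono_neutral_cong_right) (auto simp: S'_def b1_def)
  \<comment> \<open>Evaluation at \<open>t\<close>, corrected so as to kill the old family and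
    normalised to be \<open>1\<close> on \<open>F c0\<close>.\<close>
  define q where "q s = ((if s = t then 1 else 0) - (\<Sum>c\<in>C. F c t * b1 c s)) / \<alpha>" for s
  have q: "(\<Sum>s\<in>S'. q s * F c' s) = (F c' t - (\<Sum>c\<in>C. F c t * (\<Sum>s\<in>S. b c s * F c' s))) / \<alpha>" for c'
  proof -
    have "(\<Sum>s\<in>S'. q s * F c' s) =
      ((\<Sum>s\<in>S'. (if s = t then 1 else 0) * F c' s) - (\<Sum>s\<in>S'. \<Sum>c\<in>C. F c t * b1 c s * F c' s)) / \<alpha>"
      by (simp add: q_def sum_divide_distrib sum_subtractf sum_distrib_left sum_distrib_right
           left_diff_distrib diff_divide_distrib)
    also have "(\<Sum>s\<in>S'. (if s = t then 1 else 0) * F c' s) = F c' t"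
      using fS' by (simp add: S'_def if_distrib[of "\<lambda>x. x * _"] cong: if_cong)
    also have "(\<Sum>s\<in>S'. \<Sum>c\<in>C. F c t * b1 c s * F c' s) = (\<Sum>c\<in>C. F c t * (\<Sum>s\<in>S'. b1 c s * F c' s))"
      by (subst sum.swap) (simp add: sum_distrib_left mult.assoc)
    finally show ?thesis by (simp add: b1)
  qed
  have q0: "(\<Sum>s\<in>S'. q s * F c0 s) = 1"
    using \<alpha> unfolding q \<beta>_def[symmetric] by (simp add: mult.commute)
  have qC: "(\<Sum>s\<in>S'. q s * F c' s) = 0" if "c' \<in> C" for c'
  proof -
    have "(\<Sum>c\<in>C. F c t * (\<Sum>s\<in>S. b c s * F c' s)) = (\<Sum>c\<in>C. if c = c' then F c t else 0)"
      using b that by (intro sum.cong) auto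
    then show ?thesis using that insert.hyps by (simp add: q)
  qed
  \<comment> \<open>Each old functional takes the value \<open>\<beta> c\<close> on
    \<open>F c0\<close>; subtracting \<open>\<beta> c * q\<close> removes it without changing the
    values on the old family.\<close>
  define b' where "b' c s = (if c = c0 then q s else b1 c s - \<beta> c * q s)" for c s
  have "(\<Sum>s\<in>S'. b' c s * F c' s) = (if c = c' then 1 else 0)"
    if "c \<in> insert c0 C" "c' \<in> insert c0 C" for c c'
  proof (cases "c = c0")
    case True
    then show ?thesis using that q0 qC by (auto simp: b'_def)
  next
    case False
    then have "(\<Sum>s\<in>S'. b' c s * F c' s) =
      (\<Sum>s\<in>S. b c s * F c' s) - \<beta> c * (\<Sum>s\<in>S'. q s * F c' s)"
      by (simp add: b'_def left_diff_distrib sum_subtractf b1 sum_distrib_left mult.assoc)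
    then show ?thesis using False that q0 qC b insert.hyps by (auto simp: \<beta>_def)
  qed
  then show ?case using fS' by (intro exI[of _ S'] exI[of _ b'] conjI ballI) auto
qed

text \<open>Diagonal dominance: in a kernel vector, the equation belonging to an entry of maximal
  modulus would bound that entry by strictly less than itself.\<close>

lemma indep_on_near_identity:
  fixes K :: "'a \<Rightarrow> 'a \<Rightarrow> complex"
  assumes "finite C"
    and near: "\<And>c c'. c \<in> C \<Longrightarrow> c' \<in> C \<Longrightarrow>
      norm (K c c' - (if c = c' then 1 else 0)) < 1 / (of_nat (card C) + 1)"
  shows "indep_on C C (\<lambda>c' c. K c c')"
  unfolding indep_on_def
proof (intro allI impI, rule ccontr)
  fix w assume w: "\<forall>c\<in>C. (\<Sum>c'\<in>C. w c' * K c c') = 0" and "\<not> (\<forall>a\<in>C. w a = 0)"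
  then obtain a where a: "a \<in> C" "w a \<noteq> 0" by auto
  define m where "m = Max ((\<lambda>c. norm (w c)) ` C)"
  have "m \<in> (\<lambda>c. norm (w c)) ` C" unfolding m_def using a assms by (intro Max_in) auto
  then obtain c where c: "c \<in> C" "m = norm (w c)" by auto
  have le: "norm (w c') \<le> m" if "c' \<in> C" for c'
    unfolding m_def using that assms by auto
  have "m > 0" using le[OF a(1)] a by (meson less_le_trans zero_less_norm_iff)
  have "w c = - (\<Sum>c'\<in>C. w c' * (K c c' - (if c = c' then 1 else 0)))"
  proof -
    have "(\<Sum>c'\<in>C. w c' * (K c c' - (if c = c' then 1 else 0))) =
      (\<Sum>c'\<in>C. w c' * K c c') - (\<Sum>c'\<in>C. if c = c' then w c' else 0)"
      unfolding sum_subtractf[symmetric] by (intro sum.cong) (auto simp: algebra_simps)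
    then show ?thesis using w c assms by simp
  qed
  then have "m = norm (\<Sum>c'\<in>C. w c' * (K c c' - (if c = c' then 1 else 0)))"
    using c by (metis norm_minus_cancel)
  also have "\<dots> \<le> (\<Sum>c'\<in>C. m * (1 / (of_nat (card C) + 1)))"
    unfolding norm_mult
    by (intro order_trans[OF norm_sum] sum_mono, unfold norm_mult, intro mult_mono)
       (use less_imp_le[OF near[OF c(1)]] le \<open>m > 0\<close> in simp_all)
  also have "\<dots> = m * (of_nat (card C) / (of_nat (card C) + 1))" by simp
  also have "\<dots> < m * 1"
    using \<open>m > 0\<close> by (intro mult_strict_left_mono) auto
  finally show False by simp
qed

text \<open>If both signs failed for a rank-one term, suitably scaled kernel vectors of the two
  perturbations would add up to a kernel vector of the unperturbed family.\<close>

lemma indep_on_rank_one_signs: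
  fixes M :: "'a \<Rightarrow> 's \<Rightarrow> complex" and v :: "'e \<Rightarrow> 'a \<Rightarrow> complex" and u :: "'e \<Rightarrow> 's \<Rightarrow> complex"
  assumes "finite F" "indep_on C \<Omega> M"
  shows "\<exists>\<sigma>. (\<forall>e. \<sigma> e = 1 \<or> \<sigma> e = -1) \<and>
    indep_on C \<Omega> (\<lambda>a s. M a s + (\<Sum>e\<in>F. \<sigma> e * v e a * u e s))"
  using assms(1)
proof (induction F rule: finite_induct)
  case empty
  then show ?case using assms(2) by (intro exI[of _ "\<lambda>_. 1"]) auto
next
  case (insert f F)
  then obtain \<sigma> where \<sigma>: "\<forall>e. \<sigma> e = 1 \<or> \<sigma> e = -1"
    and ind: "indep_on C \<Omega> (\<lambda>a s. M a s + (\<Sum>e\<in>F. \<sigma> e * v e a * u e s))" by blast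
  define N where "N a s = M a s + (\<Sum>e\<in>F. \<sigma> e * v e a * u e s)" for a s
  have indN: "indep_on C \<Omega> N" using ind by (simp add: N_def[abs_def])
  have *: "(\<Sum>a\<in>C. w a * (N a s + x * v f a * u f s)) =
      (\<Sum>a\<in>C. w a * N a s) + x * (\<Sum>a\<in>C. w a * v f a) * u f s" for x w s
    by (simp add: algebra_simps sum.distrib sum_distrib_left)
  have "\<exists>x. (x = 1 \<or> x = -1) \<and> indep_on C \<Omega> (\<lambda>a s. N a s + x * v f a * u f s)"
  proof (rule ccontr)
    assume "\<not> ?thesis"
    then have n1: "\<not> indep_on C \<Omega> (\<lambda>a s. N a s + 1 * v f a * u f s)"
      and n2: "\<not> indep_on C \<Omega> (\<lambda>a s. N a s + (-1) * v f a * u f s)" by blast+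
    obtain w1 a1 where w1: "\<forall>s\<in>\<Omega>. (\<Sum>a\<in>C. w1 a * (N a s + 1 * v f a * u f s)) = 0"
      and a1: "a1 \<in> C" "w1 a1 \<noteq> 0"
      using n1 unfolding indep_on_def by blast
    obtain w2 a2 where w2: "\<forall>s\<in>\<Omega>. (\<Sum>a\<in>C. w2 a * (N a s + (-1) * v f a * u f s)) = 0"
      and a2: "a2 \<in> C" "w2 a2 \<noteq> 0"
      using n2 unfolding indep_on_def by blast
    define y1 where "y1 = (\<Sum>a\<in>C. w1 a * v f a)"
    define y2 where "y2 = (\<Sum>a\<in>C. w2 a * v f a)"
    have e1: "(\<Sum>a\<in>C. w1 a * N a s) = - y1 * u f s" if "s \<in> \<Omega>" for s
      using w1 that unfolding * y1_def by (simp add: eq_neg_iff_add_eq_0)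
    have e2: "(\<Sum>a\<in>C. w2 a * N a s) = y2 * u f s" if "s \<in> \<Omega>" for s
      using w2 that unfolding * y2_def by simp
    have y1: "y1 \<noteq> 0" using indep_onD[OF indN _ a1(1), of w1] e1 a1 by auto
    have y2: "y2 \<noteq> 0" using indep_onD[OF indN _ a2(1), of w2] e2 a2 by auto
    have "y2 * w1 a + y1 * w2 a = 0" if "a \<in> C" for a
    proof (rule indep_onD[OF indN _ that])
      fix s assume s: "s \<in> \<Omega>"
      have "(\<Sum>a\<in>C. (y2 * w1 a + y1 * w2 a) * N a s) =
        y2 * (\<Sum>a\<in>C. w1 a * N a s) + y1 * (\<Sum>a\<in>C. w2 a * N a s)"
        by (simp add: algebra_simps sum.distrib sum_distrib_left)
      then show "(\<Sum>a\<in>C. (y2 * w1 a + y1 * w2 a) * N a s) = 0" using e1 e2 s by simp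
    qed
    \<comment> \<open>The combination is zero, yet its pairing with \<open>v f\<close> is
      \<open>2 * y1 * y2\<close>, which is nonzero.\<close>
    then have "(\<Sum>a\<in>C. (y2 * w1 a + y1 * w2 a) * v f a) = 0" by simp
    moreover have "(\<Sum>a\<in>C. (y2 * w1 a + y1 * w2 a) * v f a) = y2 * y1 + y1 * y2"
      unfolding y1_def[symmetric] y2_def[symmetric] distrib_right sum.distrib mult.assoc
        sum_distrib_left[symmetric] by (simp add: y1_def y2_def)
    ultimately have "y2 * y1 + y1 * y2 = 0" by simp
    then show False using y1 y2 by simp
  qed
  then obtain x where x: "x = 1 \<or> x = -1" "indep_on C \<Omega> (\<lambda>a s. N a s + x * v f a * u f s)"
    by blast
  have "M a s + (\<Sum>e\<in>insert f F. (\<sigma>(f := x)) e * v e a * u e s) = N a s + x * v f a * u f s" for a s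
  proof -
    have "(\<Sum>e\<in>F. (\<sigma>(f := x)) e * v e a * u e s) = (\<Sum>e\<in>F. \<sigma> e * v e a * u e s)"
      using insert.hyps by (intro sum.cong) auto
    then show ?thesis using insert.hyps by (simp add: N_def)
  qed
  then show ?case using x \<sigma> by (intro exI[of _ "\<sigma>(f := x)"]) (simp add: fun_upd_def)
qed

lemma indep_on_combinations:
  assumes ind: "indep_on C C' (\<lambda>a c. \<Sum>s\<in>S. b c s * F a s)" and "S \<subseteq> \<Omega>"
  shows "indep_on C \<Omega> F"
  unfolding indep_on_def
proof (intro allI impI ballI)
  fix w a assume w: "\<forall>s\<in>\<Omega>. (\<Sum>a\<in>C. w a * F a s) = 0" and a: "a \<in> C"
  have "(\<Sum>a\<in>C. w a * (\<Sum>s\<in>S. b c s * F a s)) = 0" for c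
  proof -
    have "(\<Sum>a\<in>C. w a * (\<Sum>s\<in>S. b c s * F a s)) = (\<Sum>s\<in>S. b c s * (\<Sum>a\<in>C. w a * F a s))"
      unfolding sum_distrib_left by (subst sum.swap) (simp add: mult_ac)
    also have "\<dots> = 0" using w assms(2) by (intro sum.neutral) auto
    finally show ?thesis .
  qed
  then show "w a = 0" by (rule indep_onD[OF ind _ a, of w])
qed

text \<open>Independence is an open condition: paired with a dual family of \<open>F0\<close>, the
  perturbed family gives a matrix \<open>K t\<close> that tends to the identity.\<close>

lemma eventually_indep_on:
  fixes F :: "'t \<Rightarrow> 'a \<Rightarrow> 's \<Rightarrow> complex"
  assumes C: "finite C" and ind: "indep_on C \<Omega> F0"
    and lim: "\<And>c s. c \<in> C \<Longrightarrow> s \<in> \<Omega> \<Longrightarrow> ((\<lambda>t. F t c s) \<longlongrightarrow> F0 c s) net"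
  shows "eventually (\<lambda>t. indep_on C \<Omega> (F t)) net"
proof -
  from indep_on_dual[OF C ind] obtain S b where Sb: "finite S \<and> S \<subseteq> \<Omega> \<and>
    (\<forall>c\<in>C. \<forall>c'\<in>C. (\<Sum>s\<in>S. b c s * F0 c' s) = (if c = c' then 1 else 0))"
    by (elim exE) (rule that)
  note b = conjunct2[OF conjunct2[OF Sb], rule_format]
  define K where "K t c c' = (\<Sum>s\<in>S. b c s * F t c' s)" for t c c'
  have "((\<lambda>t. K t c c') \<longlongrightarrow> (if c = c' then 1 else 0)) net" if "c \<in> C" "c' \<in> C" for c c'
    unfolding b[OF that, symmetric] K_def
    using that Sb by (intro tendsto_sum tendsto_mult tendsto_const lim) auto
  then have "eventually (\<lambda>t. \<forall>c\<in>C. \<forall>c'\<in>C.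
      dist (K t c c') (if c = c' then 1 else 0) < 1 / (of_nat (card C) + 1)) net"
    using C by (intro eventually_ball_finite ballI tendstoD) auto
  then show ?thesis
  proof (rule eventually_mono)
    fix t assume "\<forall>c\<in>C. \<forall>c'\<in>C. dist (K t c c') (if c = c' then 1 else 0) < 1 / (of_nat (card C) + 1)"
    then have "indep_on C C (\<lambda>c' c. K t c c')"
      by (intro indep_on_near_identity[OF C]) (auto simp: dist_norm)
    then show "indep_on C \<Omega> (F t)"
      unfolding K_def by (rule indep_on_combinations) (use Sb in blast)
  qed
qed

lemma indep_on_coefficients:
  assumes C: "finite C" and ind: "indep_on C \<Omega> F" and dep: "\<not> indep_on (insert e C) \<Omega> F"
  shows "\<exists>\<alpha>. \<forall>s\<in>\<Omega>. F e s = (\<Sum>c\<in>C. \<alpha> c * F c s)"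
proof -
  have e: "e \<notin> C" using ind dep by (auto simp: insert_absorb)
  obtain w a where w: "\<And>s. s \<in> \<Omega> \<Longrightarrow> (\<Sum>c\<in>insert e C. w c * F c s) = 0"
    and a: "a \<in> insert e C" "w a \<noteq> 0"
    using dep unfolding indep_on_def by blast
  have sum: "w e * F e s = - (\<Sum>c\<in>C. w c * F c s)" if "s \<in> \<Omega>" for s
    using w[OF that] C e by (simp add: eq_neg_iff_add_eq_0)
  have we: "w e \<noteq> 0"
  proof
    assume "w e = 0"
    then have "w a = 0" using a indep_onD[OF ind, of w a] sum by auto
    then show False using a by simp
  qed
  have "F e s = (\<Sum>c\<in>C. (- w c / w e) * F c s)" if "s \<in> \<Omega>" for s
  proof -
    have "F e s = - (\<Sum>c\<in>C. w c * F c s) / w e" using sum[OF that] we by (simp add: field_simps)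
    then show ?thesis by (simp add: sum_divide_distrib sum_negf)
  qed
  then show ?thesis by (intro exI[of _ "\<lambda>c. - w c / w e"]) blast
qed

lemma indep_on_exchange:
  assumes C: "finite C" and ind: "indep_on C \<Omega> F" and e: "e \<notin> C" and c0: "c0 \<in> C" "\<alpha> c0 \<noteq> 0"
    and \<alpha>: "\<And>s. s \<in> \<Omega> \<Longrightarrow> F e s = (\<Sum>c\<in>C. \<alpha> c * F c s)"
  shows "indep_on (insert e (C - {c0})) \<Omega> F"
  unfolding indep_on_def
proof (intro allI impI)
  fix w assume w: "\<forall>s\<in>\<Omega>. (\<Sum>c\<in>insert e (C - {c0}). w c * F c s) = 0"
  define w' where "w' c = w e * \<alpha> c + (if c = c0 then 0 else w c)" for c
  have "(\<Sum>c\<in>C. w' c * F c s) = 0" if s: "s \<in> \<Omega>" for s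
  proof -
    have "(\<Sum>c\<in>C. w' c * F c s) = w e * F e s + (\<Sum>c\<in>C. (if c = c0 then 0 else w c) * F c s)"
      unfolding \<alpha>[OF s] by (simp add: w'_def distrib_right sum.distrib sum_distrib_left mult.assoc)
    also have "(\<Sum>c\<in>C. (if c = c0 then 0 else w c) * F c s) = (\<Sum>c\<in>C - {c0}. w c * F c s)"
      using C by (intro sum.mono_neutral_cong_right) auto
    finally show ?thesis using w s C e by simp
  qed
  then have w': "w' c = 0" if "c \<in> C" for c using indep_onD[OF ind, of w' c] that by blast
  have "w e = 0" using w'[OF c0(1)] c0(2) by (simp add: w'_def)
  moreover have "w c = 0" if "c \<in> C - {c0}" for c
    using w'[of c] that \<open>w e = 0\<close> by (auto simp: w'_def)
  ultimately show "\<forall>a\<in>insert e (C - {c0}). w a = 0" by blast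
qed

section \<open>Polynomial functions\<close>

lemma polyfun_cmult: "f \<in> polyfun I \<Longrightarrow> (\<lambda>x. c * f x) \<in> polyfun I"
  by (intro pmult pconst)

lemma polyfun_sum:
  "(\<And>a. a \<in> A \<Longrightarrow> f a \<in> polyfun I) \<Longrightarrow> (\<lambda>x. \<Sum>a\<in>A. f a x) \<in> polyfun I"
  by (induction A rule: infinite_finite_induct) (auto intro: pconst padd)

lemma polyfun_power: "f \<in> polyfun I \<Longrightarrow> (\<lambda>x. f x ^ m) \<in> polyfun I"
  by (induction m) (auto intro: pconst pmult)

lemma polyfun_compose:
  assumes "f \<in> polyfun I" "\<And>i. i \<in> I \<Longrightarrow> (\<lambda>z. \<phi> z i) \<in> polyfun J"
  shows "(\<lambda>z. f (\<phi> z)) \<in> polyfun J"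
  using assms(1) by (induction rule: polyfun.induct) (auto intro: pconst padd pmult assms(2))

lemma polyfun_line:
  assumes "f \<in> polyfun I"
  shows "\<exists>P :: complex poly. \<forall>t. f (\<lambda>i. x i + t * v i) = poly P t"
  using assms
proof (induction rule: polyfun.induct)
  case (pconst c)
  show ?case by (intro exI[of _ "[:c:]"]) simp
next
  case (pvar i)
  show ?case by (intro exI[of _ "[:x i, v i:]"]) simp
next
  case (padd f g)
  then obtain P Q where "\<forall>t. f (\<lambda>i. x i + t * v i) = poly P t" "\<forall>t. g (\<lambda>i. x i + t * v i) = poly Q t"
    by blast
  then show ?case by (intro exI[of _ "P + Q"]) simp
next
  case (pmult f g)
  then obtain P Q where "\<forall>t. f (\<lambda>i. x i + t * v i) = poly P t" "\<forall>t. g (\<lambda>i. x i + t * v i) = poly Q t"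
    by blast
  then show ?case by (intro exI[of _ "P * Q"]) simp
qed

text \<open>On the line through a point where \<open>f\<close> is nonzero and a point where
  \<open>g\<close> is nonzero, both become nonzero univariate polynomials, whose product cannot
  vanish.\<close>

lemma polyfun_mult_eq_0:
  assumes f: "f \<in> polyfun I" and g: "g \<in> polyfun I" and fg: "\<And>x. f x * g x = 0"
  shows "(\<forall>x. f x = 0) \<or> (\<forall>x. g x = 0)"
proof (rule ccontr)
  assume "\<not> ?thesis"
  then obtain x y where xy: "f x \<noteq> 0" "g y \<noteq> 0" by blast
  obtain P :: "complex poly" where P: "\<And>t. f (\<lambda>i. x i + t * (y i - x i)) = poly P t"
    using polyfun_line[OF f, of x "\<lambda>i. y i - x i"] by blast
  obtain Q :: "complex poly" where Q: "\<And>t. g (\<lambda>i. x i + t * (y i - x i)) = poly Q t"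
    using polyfun_line[OF g, of x "\<lambda>i. y i - x i"] by blast
  have "poly (P * Q) = poly 0"
    by (rule ext) (simp add: P[symmetric] Q[symmetric] fg del: mult_eq_0_iff)
  then have "P * Q = 0" by (simp only: poly_eq_poly_eq_iff)
  moreover have "poly P 0 \<noteq> 0" "poly Q 1 \<noteq> 0"
    using xy by (simp_all add: P[symmetric] Q[symmetric])
  ultimately show False by auto
qed

text \<open>Since \<open>polyfun\<close> consists of functions and not of formal polynomials, the
  partial derivatives are characterised by the chain rule along curves.\<close>

definition gradient_on ::
  "'i set \<Rightarrow> (('i \<Rightarrow> complex) \<Rightarrow> complex) \<Rightarrow> ('i \<Rightarrow> ('i \<Rightarrow> complex) \<Rightarrow> complex) \<Rightarrow> bool" where
  "gradient_on I f G \<longleftrightarrow> (\<forall>i\<in>I. G i \<in> polyfun I) \<and>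
    (\<forall>\<gamma> \<gamma>' t. (\<forall>i\<in>I. ((\<lambda>t::complex. \<gamma> t i) has_field_derivative \<gamma>' i) (at t)) \<longrightarrow>
      ((\<lambda>t. f (\<gamma> t)) has_field_derivative (\<Sum>i\<in>I. \<gamma>' i * G i (\<gamma> t))) (at t))"

lemma gradient_onD:
  assumes "gradient_on I f G"
  shows "i \<in> I \<Longrightarrow> G i \<in> polyfun I"
    and "(\<And>i. i \<in> I \<Longrightarrow> ((\<lambda>t::complex. \<gamma> t i) has_field_derivative \<gamma>' i) (at t)) \<Longrightarrow>
      ((\<lambda>t. f (\<gamma> t)) has_field_derivative (\<Sum>i\<in>I. \<gamma>' i * G i (\<gamma> t))) (at t)"
  using assms by (simp_all add: gradient_on_def)

lemma polyfun_gradient: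
  assumes "finite I" "f \<in> polyfun I"
  shows "\<exists>G. gradient_on I f G"
  using assms(2)
proof (induction rule: polyfun.induct)
  case (pconst c)
  show ?case unfolding gradient_on_def
    by (intro exI[of _ "\<lambda>_ _. 0"]) (auto intro: polyfun.pconst)
next
  case (pvar j)
  have "(\<Sum>i\<in>I. \<gamma>' i * (if i = j then 1 else 0)) = \<gamma>' j" for \<gamma>' :: "'a \<Rightarrow> complex"
    using pvar assms(1) by (simp add: if_distrib cong: if_cong)
  then show ?case using pvar unfolding gradient_on_def
    by (intro exI[of _ "\<lambda>i _. if i = j then 1 else 0"]) (auto intro: polyfun.pconst)
next
  case (padd f g)
  then obtain F G where "gradient_on I f F" "gradient_on I g G" by blast
  then have "gradient_on I (\<lambda>x. f x + g x) (\<lambda>i x. F i x + G i x)"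
    unfolding gradient_on_def
    by (auto simp: distrib_left sum.distrib intro!: polyfun.padd DERIV_add)
  then show ?case by blast
next
  case (pmult f g)
  then obtain F G where F: "gradient_on I f F" and G: "gradient_on I g G" by blast
  have "gradient_on I (\<lambda>x. f x * g x) (\<lambda>i x. F i x * g x + f x * G i x)"
    unfolding gradient_on_def
  proof (intro conjI ballI allI impI)
    show "(\<lambda>x. F i x * g x + f x * G i x) \<in> polyfun I" if "i \<in> I" for i
      using that gradient_onD(1)[OF F] gradient_onD(1)[OF G] pmult.hyps
      by (intro polyfun.padd polyfun.pmult) auto
    fix \<gamma> :: "complex \<Rightarrow> 'a \<Rightarrow> complex" and \<gamma>' t
    assume "\<forall>i\<in>I. ((\<lambda>t. \<gamma> t i) has_field_derivative \<gamma>' i) (at t)"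
    then have "((\<lambda>t. f (\<gamma> t) * g (\<gamma> t)) has_field_derivative
      (\<Sum>i\<in>I. \<gamma>' i * F i (\<gamma> t)) * g (\<gamma> t) + (\<Sum>i\<in>I. \<gamma>' i * G i (\<gamma> t)) * f (\<gamma> t)) (at t)"
      by (intro DERIV_mult gradient_onD(2)[OF F] gradient_onD(2)[OF G]) auto
    also have "(\<Sum>i\<in>I. \<gamma>' i * F i (\<gamma> t)) * g (\<gamma> t) + (\<Sum>i\<in>I. \<gamma>' i * G i (\<gamma> t)) * f (\<gamma> t) =
      (\<Sum>i\<in>I. \<gamma>' i * (F i (\<gamma> t) * g (\<gamma> t) + f (\<gamma> t) * G i (\<gamma> t)))"
      by (simp add: sum_distrib_left distrib_left sum.distrib mult_ac)
    finally show "((\<lambda>t. f (\<gamma> t) * g (\<gamma> t)) has_field_derivative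
      (\<Sum>i\<in>I. \<gamma>' i * (F i (\<gamma> t) * g (\<gamma> t) + f (\<gamma> t) * G i (\<gamma> t)))) (at t)" .
  qed
  then show ?case by blast
qed

text \<open>Taylor expansion at \<open>x\<close>: all iterated directional derivatives stay in
  \<open>Z\<close> and so vanish at \<open>x\<close>. On the line from \<open>x\<close> to
  \<open>y\<close> this becomes an induction on the degree of a univariate polynomial, through its
  derivative.\<close>

lemma polyfun_eq_0_if_derivs_vanish:
  assumes "finite I" "f \<in> Z" "Z \<subseteq> polyfun I"
    and vanish: "\<And>f. f \<in> Z \<Longrightarrow> f x = 0"
    and grad: "\<And>f G v. f \<in> Z \<Longrightarrow> gradient_on I f G \<Longrightarrow> (\<lambda>y. \<Sum>i\<in>I. v i * G i y) \<in> Z"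
  shows "f y = 0"
proof -
  define v where "v i = y i - x i" for i
  have step: "\<exists>g\<in>Z. \<forall>t. g (\<lambda>i. x i + t * v i) = poly (pderiv P) t"
    if f: "f \<in> Z" and P: "\<And>t. f (\<lambda>i. x i + t * v i) = poly P t" for f P
  proof -
    obtain G where G: "gradient_on I f G"
      using polyfun_gradient[OF assms(1)] f assms(3) by blast
    have "(\<Sum>i\<in>I. v i * G i (\<lambda>i. x i + t * v i)) = poly (pderiv P) t" for t
    proof (rule DERIV_unique)
      show "((\<lambda>t. f (\<lambda>i. x i + t * v i)) has_field_derivative
          (\<Sum>i\<in>I. v i * G i (\<lambda>i. x i + t * v i))) (at t)"
        by (rule gradient_onD(2)[OF G]) (auto intro!: derivative_eq_intros)
      show "((\<lambda>t. f (\<lambda>i. x i + t * v i)) has_field_derivative poly (pderiv P) t) (at t)"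
        unfolding P by (rule poly_DERIV)
    qed
    then show ?thesis using grad[OF f G, of v] by (intro bexI[of _ "\<lambda>y. \<Sum>i\<in>I. v i * G i y"]) auto
  qed
  have iter: "P = 0" if "f \<in> Z" "\<And>t. f (\<lambda>i. x i + t * v i) = poly P t" for f P
    using that
  proof (induction "degree P" arbitrary: f P)
    case 0
    have "poly P 0 = 0" using 0(3)[of 0] vanish[OF 0(2)] by simp
    then show ?case using degree_eq_zeroE[OF 0(1)[symmetric]] by force
  next
    case (Suc m)
    obtain g where g: "g \<in> Z" "\<And>t. g (\<lambda>i. x i + t * v i) = poly (pderiv P) t"
      using step[OF Suc.prems] by blast
    have "pderiv P = 0" using Suc.hyps(2) by (intro Suc.hyps(1)[OF _ g]) (simp add: degree_pderiv)
    then show ?case using Suc.hyps(2) by (simp add: pderiv_eq_0_iff)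
  qed
  obtain P :: "complex poly" where P: "\<And>t. f (\<lambda>i. x i + t * v i) = poly P t"
    using polyfun_line[of f I x v] assms by blast
  have "f (\<lambda>i. x i + 1 * v i) = 0" using P[of 1] iter[OF assms(2) P] by simp
  then show ?thesis by (simp add: v_def)
qed

section \<open>Irreducible closed sets and dimension\<close>

lemma zariski_closure_eq:
  assumes "S \<subseteq> cspace I"
  shows "zariski_closure I S = {x \<in> cspace I. \<forall>f\<in>polyfun I. (\<forall>s\<in>S. f s = 0) \<longrightarrow> f x = 0}"
proof (intro equalityI subsetI)
  fix x assume x: "x \<in> zariski_closure I S"
  have "zariski_closed I {x \<in> cspace I. \<forall>f\<in>{f\<in>polyfun I. \<forall>s\<in>S. f s = 0}. f x = 0}"
    unfolding zariski_closed_def by blast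
  then show "x \<in> {x \<in> cspace I. \<forall>f\<in>polyfun I. (\<forall>s\<in>S. f s = 0) \<longrightarrow> f x = 0}"
    using x assms unfolding zariski_closure_def by (auto dest!: spec)
next
  fix x assume "x \<in> {x \<in> cspace I. \<forall>f\<in>polyfun I. (\<forall>s\<in>S. f s = 0) \<longrightarrow> f x = 0}"
  then show "x \<in> zariski_closure I S"
    unfolding zariski_closure_def zariski_closed_def by blast
qed

lemma zariski_closed_closure: "S \<subseteq> cspace I \<Longrightarrow> zariski_closed I (zariski_closure I S)"
  unfolding zariski_closed_def zariski_closure_eq
  by (intro exI[of _ "{f\<in>polyfun I. \<forall>s\<in>S. f s = 0}"]) auto

lemma zariski_closed_Int_zero:
  assumes "zariski_closed I T" "f \<in> polyfun I"
  shows "zariski_closed I {x\<in>T. f x = 0}"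
proof -
  obtain P where "P \<subseteq> polyfun I" "T = {x \<in> cspace I. \<forall>f\<in>P. f x = 0}"
    using assms(1) unfolding zariski_closed_def by blast
  then show ?thesis using assms(2) unfolding zariski_closed_def
    by (intro exI[of _ "insert f P"]) auto
qed

lemma zariski_irreducibleD:
  assumes "zariski_irreducible I T"
  shows "zariski_closed I T" "T \<noteq> {}" "T \<subseteq> cspace I"
    "\<lbrakk>zariski_closed I A; zariski_closed I B; T = A \<union> B\<rbrakk> \<Longrightarrow> T = A \<or> T = B"
  using assms by (auto simp: zariski_irreducible_def zariski_closed_def[of I T])

text \<open>The vanishing ideal of an irreducible set is prime: the zero sets of the two factors
  cover \<open>T\<close>.\<close>

lemma zariski_irreducible_mult:
  assumes T: "zariski_irreducible I T" and f: "f \<in> polyfun I" and g: "g \<in> polyfun I"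
    and fg: "\<And>x. x \<in> T \<Longrightarrow> f x * g x = 0"
  shows "(\<forall>x\<in>T. f x = 0) \<or> (\<forall>x\<in>T. g x = 0)"
proof -
  have "zariski_closed I {x\<in>T. f x = 0}" "zariski_closed I {x\<in>T. g x = 0}"
    using f g zariski_irreducibleD(1)[OF T] by (auto intro: zariski_closed_Int_zero)
  moreover have "T = {x\<in>T. f x = 0} \<union> {x\<in>T. g x = 0}" using fg by auto
  ultimately have "T = {x\<in>T. f x = 0} \<or> T = {x\<in>T. g x = 0}"
    by (rule zariski_irreducibleD(4)[OF T])
  then show ?thesis by blast
qed

text \<open>A closed set properly inside the closure is cut out by some polynomial that pulls back
  to a nonzero polynomial on the parameter space. Two such sets covering the closure would make a
  product of nonzero polynomials vanish.\<close>

lemma zariski_irreducible_closure_range: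
  assumes \<phi>: "\<And>i. i \<in> I \<Longrightarrow> (\<lambda>z. \<phi> z i) \<in> polyfun J" and sub: "range \<phi> \<subseteq> cspace I"
  shows "zariski_irreducible I (zariski_closure I (range \<phi>))"
proof -
  let ?T = "zariski_closure I (range \<phi>)"
  have eq: "?T = {x \<in> cspace I. \<forall>f\<in>polyfun I. (\<forall>z. f (\<phi> z) = 0) \<longrightarrow> f x = 0}"
    using zariski_closure_eq[OF sub] by simp
  have range: "range \<phi> \<subseteq> ?T" using sub by (auto simp: eq)
  have "?T = A \<or> ?T = B" if A: "zariski_closed I A" and B: "zariski_closed I B" and AB: "?T = A \<union> B" for A B
  proof (rule ccontr)
    assume neg: "\<not> (?T = A \<or> ?T = B)"
    have sep: "\<exists>f\<in>polyfun I. (\<forall>x\<in>A. f x = 0) \<and> (\<exists>z. f (\<phi> z) \<noteq> 0)"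
      if A: "zariski_closed I A" and strict: "A \<subset> ?T" for A
    proof -
      obtain P where P: "P \<subseteq> polyfun I" "A = {x \<in> cspace I. \<forall>f\<in>P. f x = 0}"
        using A unfolding zariski_closed_def by blast
      obtain x where "x \<in> ?T" "x \<notin> A" using strict by blast
      then obtain f where "f \<in> P" "f x \<noteq> 0" using P eq by auto
      then show ?thesis using P \<open>x \<in> ?T\<close> eq by blast
    qed
    obtain f where f: "f \<in> polyfun I" "\<forall>x\<in>A. f x = 0" "\<exists>z. f (\<phi> z) \<noteq> 0"
      using sep[OF A] AB neg by blast
    obtain g where g: "g \<in> polyfun I" "\<forall>x\<in>B. g x = 0" "\<exists>z. g (\<phi> z) \<noteq> 0"
      using sep[OF B] AB neg by blast
    have "f (\<phi> z) * g (\<phi> z) = 0" for z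
    proof -
      have "\<phi> z \<in> A \<union> B" using range AB by auto
      then show ?thesis using f(2) g(2) by auto
    qed
    moreover have "(\<lambda>z. f (\<phi> z)) \<in> polyfun J" "(\<lambda>z. g (\<phi> z)) \<in> polyfun J"
      using f(1) g(1) \<phi> by (auto intro: polyfun_compose)
    ultimately show False
      using polyfun_mult_eq_0[of "\<lambda>z. f (\<phi> z)" J "\<lambda>z. g (\<phi> z)"] f(3) g(3) by blast
  qed
  then show ?thesis
    unfolding zariski_irreducible_def using zariski_closed_closure[OF sub] range by blast
qed

section \<open>Polynomials of bounded degree and the upper bound for the dimension\<close>

definition box_poly :: "'j set \<Rightarrow> nat \<Rightarrow> (('j \<Rightarrow> complex) \<Rightarrow> complex) set" where
  "box_poly J b = {g. \<exists>\<kappa>. \<forall>z. g z = (\<Sum>\<beta>\<in>(\<Pi>\<^sub>E c\<in>J. {..b}). \<kappa> \<beta> * (\<Prod>c\<in>J. z c ^ \<beta> c))}"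

lemma box_poly_add:
  assumes "f \<in> box_poly J b" "g \<in> box_poly J b"
  shows "(\<lambda>z. f z + g z) \<in> box_poly J b"
proof -
  obtain \<kappa> \<mu> where "\<forall>z. f z = (\<Sum>\<beta>\<in>(\<Pi>\<^sub>E c\<in>J. {..b}). \<kappa> \<beta> * (\<Prod>c\<in>J. z c ^ \<beta> c))"
    "\<forall>z. g z = (\<Sum>\<beta>\<in>(\<Pi>\<^sub>E c\<in>J. {..b}). \<mu> \<beta> * (\<Prod>c\<in>J. z c ^ \<beta> c))"
    using assms unfolding box_poly_def by blast
  then show ?thesis unfolding box_poly_def
    by (auto simp: distrib_right sum.distrib intro!: exI[of _ "\<lambda>\<beta>. \<kappa> \<beta> + \<mu> \<beta>"])
qed

lemma box_poly_cmult:
  assumes "f \<in> box_poly J b"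
  shows "(\<lambda>z. x * f z) \<in> box_poly J b"
proof -
  obtain \<kappa> where "\<forall>z. f z = (\<Sum>\<beta>\<in>(\<Pi>\<^sub>E c\<in>J. {..b}). \<kappa> \<beta> * (\<Prod>c\<in>J. z c ^ \<beta> c))"
    using assms unfolding box_poly_def by blast
  then show ?thesis unfolding box_poly_def
    by (auto simp: sum_distrib_left mult.assoc intro!: exI[of _ "\<lambda>\<beta>. x * \<kappa> \<beta>"])
qed

lemma box_poly_monomial:
  assumes "finite J" "\<And>c. c \<in> J \<Longrightarrow> \<beta> c \<le> b"
  shows "(\<lambda>z. \<Prod>c\<in>J. z c ^ \<beta> c) \<in> box_poly J b"
proof -
  have fin: "finite (\<Pi>\<^sub>E c\<in>J. {..b})" using assms by (intro finite_PiE) auto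
  have mem: "restrict \<beta> J \<in> (\<Pi>\<^sub>E c\<in>J. {..b})" using assms by auto
  have "(\<Prod>c\<in>J. z c ^ \<beta> c) = (\<Sum>\<gamma>\<in>(\<Pi>\<^sub>E c\<in>J. {..b}). (if \<gamma> = restrict \<beta> J then 1 else 0) * (\<Prod>c\<in>J. z c ^ \<gamma> c))" for z :: "'a \<Rightarrow> complex"
    using fin mem by (simp add: if_distrib[of "\<lambda>x. x * _"] cong: if_cong)
  then show ?thesis unfolding box_poly_def
    by (auto intro!: exI[of _ "\<lambda>\<gamma>. if \<gamma> = restrict \<beta> J then 1 else 0"])
qed

lemma box_poly_const: "finite J \<Longrightarrow> (\<lambda>z. x) \<in> box_poly J b"
  using box_poly_cmult[OF box_poly_monomial[of J "\<lambda>_. 0" b], of x] by simp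

lemma box_poly_sum:
  "finite J \<Longrightarrow> (\<And>a. a \<in> A \<Longrightarrow> f a \<in> box_poly J b) \<Longrightarrow> (\<lambda>z. \<Sum>a\<in>A. f a z) \<in> box_poly J b"
  by (induction A rule: infinite_finite_induct) (auto intro: box_poly_const box_poly_add)

lemma box_poly_mult:
  assumes "finite J" "f \<in> box_poly J a" "g \<in> box_poly J b"
  shows "(\<lambda>z. f z * g z) \<in> box_poly J (a + b)"
proof -
  obtain \<kappa> where \<kappa>: "\<And>z. f z = (\<Sum>\<beta>\<in>(\<Pi>\<^sub>E c\<in>J. {..a}). \<kappa> \<beta> * (\<Prod>c\<in>J. z c ^ \<beta> c))"
    using assms unfolding box_poly_def by blast
  obtain \<mu> where \<mu>: "\<And>z. g z = (\<Sum>\<beta>\<in>(\<Pi>\<^sub>E c\<in>J. {..b}). \<mu> \<beta> * (\<Prod>c\<in>J. z c ^ \<beta> c))"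
    using assms unfolding box_poly_def by blast
  have "f z * g z = (\<Sum>\<beta>\<in>(\<Pi>\<^sub>E c\<in>J. {..a}). \<Sum>\<gamma>\<in>(\<Pi>\<^sub>E c\<in>J. {..b}).
      (\<kappa> \<beta> * \<mu> \<gamma>) * (\<Prod>c\<in>J. z c ^ (\<beta> c + \<gamma> c)))" for z
    by (simp add: \<kappa> \<mu> sum_product power_add prod.distrib mult_ac)
  moreover have "(\<lambda>z. \<Prod>c\<in>J. z c ^ (\<beta> c + \<gamma> c)) \<in> box_poly J (a + b)"
    if "\<beta> \<in> (\<Pi>\<^sub>E c\<in>J. {..a})" "\<gamma> \<in> (\<Pi>\<^sub>E c\<in>J. {..b})" for \<beta> \<gamma>
    using that assms(1) by (intro box_poly_monomial add_mono) (auto simp: PiE_iff)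
  ultimately show ?thesis
    using assms(1) by (simp add: box_poly_sum box_poly_cmult)
qed

lemma box_poly_mono:
  assumes "finite J" "f \<in> box_poly J a" "a \<le> b"
  shows "f \<in> box_poly J b"
  using box_poly_mult[OF assms(1,2) box_poly_const[OF assms(1), of 1 "b - a"]] assms(3) by simp

lemma box_poly_power:
  assumes "finite J" "f \<in> box_poly J a"
  shows "(\<lambda>z. f z ^ m) \<in> box_poly J (a * m)"
proof (induction m)
  case 0
  show ?case using assms(1) by (simp add: box_poly_const)
next
  case (Suc m)
  then show ?case using box_poly_mult[OF assms Suc] by (simp add: add.commute)
qed

lemma polyfun_in_box_poly:
  assumes "finite J" "f \<in> polyfun J"
  shows "\<exists>b. f \<in> box_poly J b"
  using assms(2)
proof (induction rule: polyfun.induct)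
  case (pconst c)
  show ?case using box_poly_const[OF assms(1)] by blast
next
  case (pvar i)
  have "(\<lambda>z. \<Prod>c\<in>J. z c ^ (if c = i then 1 else 0)) \<in> box_poly J 1"
    using assms(1) by (intro box_poly_monomial) auto
  moreover have "(\<Prod>c\<in>J. z c ^ (if c = i then 1 else 0)) = z i" for z :: "'a \<Rightarrow> complex"
    using pvar assms(1) by (simp add: if_distrib[of "power _"] cong: if_cong)
  ultimately show ?case by auto
next
  case (padd f g)
  then obtain a b where "f \<in> box_poly J a" "g \<in> box_poly J b" by blast
  then have "f \<in> box_poly J (a + b)" "g \<in> box_poly J (a + b)"
    using assms(1) by (auto intro: box_poly_mono)
  then show ?case using box_poly_add by blast
next
  case (pmult f g)
  then show ?case using box_poly_mult[OF assms(1)] by blast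
qed

text \<open>Bounding the degree in each variable separately leaves exactly
  \<open>(b + 1) ^ card J\<close> exponent vectors, so more than that many coefficient vectors are
  dependent.\<close>

lemma box_poly_dependent:
  assumes "finite J" "\<And>a. a < m \<Longrightarrow> g a \<in> box_poly J b" "(b + 1) ^ card J < m"
  shows "\<not> indep_on {..<m} UNIV g"
proof -
  let ?B = "\<Pi>\<^sub>E c\<in>J. {..b}"
  have "\<forall>a. \<exists>\<kappa>. a < m \<longrightarrow> (\<forall>z. g a z = (\<Sum>\<beta>\<in>?B. \<kappa> \<beta> * (\<Prod>c\<in>J. z c ^ \<beta> c)))"
    using assms(2) unfolding box_poly_def by blast
  then obtain \<kappa> where \<kappa>: "\<And>a z. a < m \<Longrightarrow> g a z = (\<Sum>\<beta>\<in>?B. \<kappa> a \<beta> * (\<Prod>c\<in>J. z c ^ \<beta> c))"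
    by metis
  have "\<not> indep_on {..<m} ?B \<kappa>"
    using assms by (intro not_indep_on_if_card_less finite_PiE) (auto simp: card_PiE)
  then obtain w a where w: "\<And>\<beta>. \<beta> \<in> ?B \<Longrightarrow> (\<Sum>a<m. w a * \<kappa> a \<beta>) = 0" and a: "a < m" "w a \<noteq> 0"
    unfolding indep_on_def by blast
  have "(\<Sum>a<m. w a * g a z) = 0" for z
  proof -
    have "(\<Sum>a<m. w a * g a z) = (\<Sum>a<m. \<Sum>\<beta>\<in>?B. w a * \<kappa> a \<beta> * (\<Prod>c\<in>J. z c ^ \<beta> c))"
      by (intro sum.cong) (auto simp: \<kappa> sum_distrib_left mult.assoc)
    also have "\<dots> = (\<Sum>\<beta>\<in>?B. (\<Sum>a<m. w a * \<kappa> a \<beta>) * (\<Prod>c\<in>J. z c ^ \<beta> c))"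
      by (subst sum.swap) (simp add: sum_distrib_right)
    finally show ?thesis by (simp add: w)
  qed
  then show ?thesis using a unfolding indep_on_def by blast
qed

text \<open>The index \<open>a\<close> encodes the pair of \<open>a mod N\<close>, choosing a
  function \<open>g\<close>, and \<open>a div N\<close>, the power of \<open>f\<close>. On
  \<open>T\<close> only the zeroth power survives, so the lowest block of coefficients vanishes; the
  rest is divisible by \<open>f\<close>, which cancels because \<open>T'\<close> is irreducible and
  \<open>f\<close> is nonzero somewhere on it.\<close>

lemma indep_on_powers:
  fixes g :: "nat \<Rightarrow> ('i \<Rightarrow> complex) \<Rightarrow> complex"
  assumes T': "zariski_irreducible I T'" and "T \<subseteq> T'"
    and f: "f \<in> polyfun I" "\<And>x. x \<in> T \<Longrightarrow> f x = 0" "x0 \<in> T'" "f x0 \<noteq> 0"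
    and g: "\<And>a. a < N \<Longrightarrow> g a \<in> polyfun I" and ind: "indep_on {..<N} T g"
  shows "indep_on {..<m * N} T' (\<lambda>a x. g (a mod N) x * f x ^ (a div N))"
proof (induction m)
  case 0
  show ?case by (simp add: indep_on_def)
next
  case (Suc m)
  let ?h = "\<lambda>a x. g (a mod N) x * f x ^ (a div N)"
  have h: "?h a \<in> polyfun I" if "a < k * N" for a k
  proof -
    have "a mod N < N" using that by (cases "N = 0") auto
    then show ?thesis using f(1) g by (intro pmult polyfun_power)
  qed
  show ?case unfolding indep_on_def
  proof (intro allI impI)
    fix w assume w: "\<forall>x\<in>T'. (\<Sum>a<Suc m * N. w a * ?h a x) = 0"
    have split: "(\<Sum>a<Suc m * N. w a * ?h a x) =
      (\<Sum>a<N. w a * g a x) + f x * (\<Sum>a<m * N. w (N + a) * ?h a x)" for x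
    proof -
      have "(\<Sum>a<Suc m * N. w a * ?h a x) =
        (\<Sum>a<N. w a * ?h a x) + (\<Sum>a<m * N. w (N + a) * ?h (N + a) x)"
        using sum.atLeastLessThan_concat[of 0 N "Suc m * N" "\<lambda>a. w a * ?h a x", symmetric]
          sum.shift_bounds_nat_ivl[of "\<lambda>a. w a * ?h a x" 0 N "m * N"]
        by (simp add: lessThan_atLeast0 add.commute)
      also have "(\<Sum>a<N. w a * ?h a x) = (\<Sum>a<N. w a * g a x)"
        by (intro sum.cong) auto
      also have "(\<Sum>a<m * N. w (N + a) * ?h (N + a) x) = f x * (\<Sum>a<m * N. w (N + a) * ?h a x)"
        unfolding sum_distrib_left
      proof (intro sum.cong refl)
        fix a assume "a \<in> {..<m * N}"
        then have "N > 0" by (auto intro: gr0I)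
        then show "w (N + a) * ?h (N + a) x = f x * (w (N + a) * ?h a x)" by simp
      qed
      finally show ?thesis .
    qed
    have low: "w a = 0" if "a < N" for a
    proof (rule indep_onD[OF ind])
      fix x assume "x \<in> T"
      then show "(\<Sum>a<N. w a * g a x) = 0"
        using w[rule_format, of x] f(2)[of x] \<open>T \<subseteq> T'\<close> unfolding split by auto
    qed (use that in auto)
    have "f x * (\<Sum>a<m * N. w (N + a) * ?h a x) = 0" if "x \<in> T'" for x
      using w[rule_format, OF that] unfolding split by (simp add: low)
    then have "(\<forall>x\<in>T'. f x = 0) \<or> (\<forall>x\<in>T'. (\<Sum>a<m * N. w (N + a) * ?h a x) = 0)"
      using h by (intro zariski_irreducible_mult[OF T' f(1)] polyfun_sum polyfun_cmult) auto
    then have "\<forall>x\<in>T'. (\<Sum>a<m * N. w (N + a) * ?h a x) = 0" using f(3,4) by blast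
    then have high: "w (N + a) = 0" if "a < m * N" for a
      using indep_onD[OF Suc.IH, of "\<lambda>a. w (N + a)" a] that by auto
    show "\<forall>a\<in>{..<Suc m * N}. w a = 0"
    proof
      fix a assume "a \<in> {..<Suc m * N}"
      then show "w a = 0" using low[of a] high[of "a - N"] by (cases "a < N") auto
    qed
  qed
qed

text \<open>A chain of length \<open>k\<close> produces \<open>s ^ k\<close> independent products of powers whose degree is
  linear in \<open>s\<close>, whereas only \<open>O(s ^ card J)\<close> fit into the parameter space.\<close>

lemma chain_indep_powers:
  assumes J: "finite J" and \<phi>: "\<And>i. i \<in> I \<Longrightarrow> (\<lambda>z. \<phi> z i) \<in> polyfun J"
    and T: "\<And>j. j \<le> k \<Longrightarrow> zariski_irreducible I (T j)" "\<And>j. j < k \<Longrightarrow> T j \<subset> T (Suc j)"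
    and "j \<le> k"
  shows "\<exists>A. \<forall>s. \<exists>g :: nat \<Rightarrow> ('i \<Rightarrow> complex) \<Rightarrow> complex. indep_on {..<s ^ j} (T j) g \<and>
    (\<forall>a<s ^ j. g a \<in> polyfun I \<and> (\<lambda>z. g a (\<phi> z)) \<in> box_poly J (A * s))"
  using \<open>j \<le> k\<close>
proof (induction j)
  case 0
  obtain x where "x \<in> T 0" using zariski_irreducibleD(2)[OF T(1)[of 0]] by blast
  then have "indep_on {..<1::nat} (T 0) (\<lambda>_ _. 1)" unfolding indep_on_def by auto
  then show ?case using box_poly_const[OF J]
    by (intro exI[of _ 0] allI exI[of _ "\<lambda>_ _. 1"]) (auto intro: pconst)
next
  case (Suc j)
  then obtain A where A: "\<And>s. \<exists>g :: nat \<Rightarrow> ('i \<Rightarrow> complex) \<Rightarrow> complex. indep_on {..<s ^ j} (T j) g \<and>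
    (\<forall>a<s ^ j. g a \<in> polyfun I \<and> (\<lambda>z. g a (\<phi> z)) \<in> box_poly J (A * s))" by auto
  have irr: "zariski_irreducible I (T j)" "zariski_irreducible I (T (Suc j))"
    and sub: "T j \<subset> T (Suc j)" using T Suc.prems by auto
  obtain P where P: "P \<subseteq> polyfun I" "T j = {x \<in> cspace I. \<forall>f\<in>P. f x = 0}"
    using zariski_irreducibleD(1)[OF irr(1)] unfolding zariski_closed_def by blast
  obtain f x0 where f: "f \<in> polyfun I" "\<And>x. x \<in> T j \<Longrightarrow> f x = 0" "x0 \<in> T (Suc j)" "f x0 \<noteq> 0"
    using sub P zariski_irreducibleD(3)[OF irr(2)] by blast
  obtain B where B: "(\<lambda>z. f (\<phi> z)) \<in> box_poly J B"
    using polyfun_in_box_poly[OF J polyfun_compose[where f = f and \<phi> = \<phi>, OF f(1)]] \<phi> by blast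
  show ?case
  \<comment> \<open>The constant must not depend on \<open>s\<close>. Fewer than \<open>s\<close>
    factors \<open>f\<close> are added in this step, at a cost in degree of at most
    \<open>B * s\<close>.\<close>
  proof (intro exI[of _ "A + B"] allI)
    fix s
    obtain g :: "nat \<Rightarrow> ('i \<Rightarrow> complex) \<Rightarrow> complex" where ind: "indep_on {..<s ^ j} (T j) g"
      and g: "\<And>a. a < s ^ j \<Longrightarrow> g a \<in> polyfun I"
        "\<And>a. a < s ^ j \<Longrightarrow> (\<lambda>z. g a (\<phi> z)) \<in> box_poly J (A * s)"
      using A[of s] by blast
    let ?h = "\<lambda>a x. g (a mod s ^ j) x * f x ^ (a div s ^ j)"
    have "indep_on {..<s * s ^ j} (T (Suc j)) ?h"
      using sub by (intro indep_on_powers[OF irr(2) _ f g(1) ind]) auto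
    moreover have "?h a \<in> polyfun I \<and> (\<lambda>z. ?h a (\<phi> z)) \<in> box_poly J ((A + B) * s)"
      if a: "a < s * s ^ j" for a
    proof -
      have *: "a mod s ^ j < s ^ j" "a div s ^ j < s"
        using a by (auto simp: less_mult_imp_div_less intro!: mod_less_divisor intro: gr0I)
      have "(\<lambda>z. f (\<phi> z) ^ (a div s ^ j)) \<in> box_poly J (B * s)"
        using * by (intro box_poly_mono[OF J box_poly_power[OF J B]]) auto
      then have "(\<lambda>z. ?h a (\<phi> z)) \<in> box_poly J (A * s + B * s)"
        by (intro box_poly_mult[OF J g(2)] *)
      then show ?thesis using g(1)[OF *(1)] f(1)
        by (auto simp: distrib_right intro!: pmult polyfun_power)
    qed
    ultimately show "\<exists>g :: nat \<Rightarrow> ('i \<Rightarrow> complex) \<Rightarrow> complex. indep_on {..<s ^ Suc j} (T (Suc j)) g \<and>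
      (\<forall>a<s ^ Suc j. g a \<in> polyfun I \<and> (\<lambda>z. g a (\<phi> z)) \<in> box_poly J ((A + B) * s))"
      by (intro exI[of _ ?h]) simp
  qed
qed

text \<open>For a chain longer than \<open>card J\<close>, the independent functions on its top
  member pull back to dependent ones. The resulting relation vanishes on
  \<open>range \<phi>\<close>, hence on \<open>S\<close>, on its closure and on the top member, a
  contradiction.\<close>

lemma alg_dim_le_card_parameters:
  fixes \<phi> :: "('j \<Rightarrow> complex) \<Rightarrow> ('i \<Rightarrow> complex)"
  assumes J: "finite J" and \<phi>: "\<And>i. i \<in> I \<Longrightarrow> (\<lambda>z. \<phi> z i) \<in> polyfun J"
    and S: "S \<subseteq> cspace I" "S \<subseteq> range \<phi>"
  shows "alg_dim I S \<le> enat (card J)"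
  unfolding alg_dim_def
proof (rule Sup_least, clarify)
  fix k and T :: "nat \<Rightarrow> ('i \<Rightarrow> complex) set"
  assume T1: "\<forall>j\<le>k. zariski_irreducible I (T j) \<and> T j \<subseteq> zariski_closure I S"
    and T2: "\<forall>j<k. T j \<subset> T (Suc j)"
  show "enat k \<le> enat (card J)"
  proof (rule ccontr)
    assume "\<not> ?thesis"
    then have k: "card J < k" by simp
    have "\<exists>A. \<forall>s. \<exists>g :: nat \<Rightarrow> ('i \<Rightarrow> complex) \<Rightarrow> complex. indep_on {..<s ^ k} (T k) g \<and>
        (\<forall>a<s ^ k. g a \<in> polyfun I \<and> (\<lambda>z. g a (\<phi> z)) \<in> box_poly J (A * s))"
      using T1 T2 by (intro chain_indep_powers[OF J \<phi>, where k = k]) auto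
    then obtain A where
      A: "\<forall>s. \<exists>g :: nat \<Rightarrow> ('i \<Rightarrow> complex) \<Rightarrow> complex. indep_on {..<s ^ k} (T k) g \<and>
        (\<forall>a<s ^ k. g a \<in> polyfun I \<and> (\<lambda>z. g a (\<phi> z)) \<in> box_poly J (A * s))"
      by (elim exE) (rule that)
    \<comment> \<open>Chosen to exceed \<open>(A + 1) ^ card J\<close>, so that \<open>s ^ k\<close>
      outgrows the number of monomials, at most
      \<open>(A + 1) ^ card J * s ^ card J\<close>.\<close>
    define s where "s = (A + 1) ^ card J + 1"
    obtain g :: "nat \<Rightarrow> ('i \<Rightarrow> complex) \<Rightarrow> complex" where ind: "indep_on {..<s ^ k} (T k) g"
      and g: "\<And>a. a < s ^ k \<Longrightarrow> g a \<in> polyfun I"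
        "\<And>a. a < s ^ k \<Longrightarrow> (\<lambda>z. g a (\<phi> z)) \<in> box_poly J (A * s)"
      using A[rule_format, of s] by blast
    have "(A * s + 1) ^ card J \<le> ((A + 1) * s) ^ card J"
      by (intro power_mono) (auto simp: s_def)
    also have "\<dots> = (A + 1) ^ card J * s ^ card J" by (rule power_mult_distrib)
    also have "\<dots> < s * s ^ card J"
      by (intro mult_strict_right_mono) (auto simp: s_def)
    also have "\<dots> \<le> s ^ k"
      using k power_increasing[of "Suc (card J)" k s] by (simp add: s_def)
    finally have "\<not> indep_on {..<s ^ k} UNIV (\<lambda>a z. g a (\<phi> z))"
      using g(2) by (intro box_poly_dependent[OF J])
    then obtain w a where w: "\<And>z. (\<Sum>a<s ^ k. w a * g a (\<phi> z)) = 0" and a: "a < s ^ k" "w a \<noteq> 0"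
      unfolding indep_on_def by blast
    define F where "F x = (\<Sum>a<s ^ k. w a * g a x)" for x
    have "F \<in> polyfun I"
      unfolding F_def using g(1) by (intro polyfun_sum polyfun_cmult) auto
    moreover have "F x = 0" if "x \<in> S" for x
      using that S(2) w unfolding F_def by auto
    ultimately have "F x = 0" if "x \<in> T k" for x
      using that T1 zariski_closure_eq[OF S(1)] by blast
    then have "w a = 0" using indep_onD[OF ind, of w a] a by (auto simp: F_def)
    then show False using a by simp
  qed
qed

section \<open>The column space and the lower bound for the dimension\<close>

definition col_comb :: "nat \<Rightarrow> (nat \<Rightarrow> 'e \<Rightarrow> complex) \<Rightarrow> 'e set \<Rightarrow> ('e \<Rightarrow> complex) \<Rightarrow> nat \<Rightarrow> complex" where
  "col_comb D E C z = (\<lambda>i. if i < D then \<Sum>c\<in>C. z c * E i c else 0)"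

lemma col_comb_polyfun: "(\<lambda>z. col_comb D E C z i) \<in> polyfun C"
  unfolding col_comb_def by (cases "i < D") (auto intro!: polyfun_sum pmult pvar pconst)

lemma col_comb_in_cspace: "col_comb D E C z \<in> cspace {..<D}"
  by (simp add: cspace_def col_comb_def)

lemma range_col_comb_mono:
  assumes "C' \<subseteq> C" "finite C"
  shows "range (col_comb D E C') \<subseteq> range (col_comb D E C)"
proof (rule image_subsetI)
  fix z
  have "(\<Sum>c\<in>C'. z c * E i c) = (\<Sum>c\<in>C. (if c \<in> C' then z c else 0) * E i c)" for i
    using assms by (intro sum.mono_neutral_cong_left) auto
  then have "col_comb D E C' z = col_comb D E C (\<lambda>c. if c \<in> C' then z c else 0)"
    by (simp add: col_comb_def cong: if_cong)
  then show "col_comb D E C' z \<in> range (col_comb D E C)" by simp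
qed

text \<open>Adding the independent columns one at a time gives a flag of subspaces, whose closures
  form a strict chain of irreducible sets of length \<open>card C\<close>.\<close>

lemma card_le_alg_dim:
  assumes C: "finite C" and ind: "indep_on C {..<D} (\<lambda>c i. E i c)"
    and dense: "range (col_comb D E C) \<subseteq> zariski_closure {..<D} S" and S: "S \<subseteq> cspace {..<D}"
  shows "enat (card C) \<le> alg_dim {..<D} S"
proof -
  let ?cl = "zariski_closure {..<D}"
  obtain h where h: "bij_betw h {..<card C} C"
    using ex_bij_betw_nat_finite[OF C] by (auto simp: lessThan_atLeast0)
  define Cs where "Cs j = h ` {..<j}" for j
  define T where "T j = ?cl (range (col_comb D E (Cs j)))" for j
  have Cs: "Cs j \<subseteq> C" if "j \<le> card C" for j
    using h that by (auto simp: Cs_def bij_betw_def)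
  have cs: "range (col_comb D E C') \<subseteq> cspace {..<D}" for C'
    using col_comb_in_cspace by blast
  have irr: "zariski_irreducible {..<D} (T j)" for j
    unfolding T_def by (rule zariski_irreducible_closure_range[OF col_comb_polyfun cs])
  have Tsub: "T j \<subseteq> ?cl S" if "j \<le> card C" for j
  proof -
    have "range (col_comb D E (Cs j)) \<subseteq> ?cl S"
      using range_col_comb_mono[OF Cs[OF that] C] dense by blast
    then show ?thesis unfolding T_def zariski_closure_eq[OF cs] zariski_closure_eq[OF S] by blast
  qed
  from indep_on_dual[OF C ind] obtain Q b where Qb: "finite Q \<and> Q \<subseteq> {..<D} \<and>
    (\<forall>c\<in>C. \<forall>c'\<in>C. (\<Sum>i\<in>Q. b c i * E i c') = (if c = c' then 1 else 0))"
    by (elim exE) (rule that)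
  have strict: "T j \<subset> T (Suc j)" if j: "j < card C" for j
  proof
    have fin: "finite (Cs (Suc j))" by (simp add: Cs_def)
    have "range (col_comb D E (Cs j)) \<subseteq> range (col_comb D E (Cs (Suc j)))"
      by (intro range_col_comb_mono fin) (auto simp: Cs_def)
    then show "T j \<subseteq> T (Suc j)" unfolding T_def zariski_closure_eq[OF cs] by blast
    have hj: "h j \<in> C" "h j \<notin> Cs j" "Cs (Suc j) = insert (h j) (Cs j)"
      using h j by (auto simp: Cs_def bij_betw_def lessThan_Suc dest: inj_onD)
    \<comment> \<open>The functional dual to the column \<open>h j\<close>: it reads off the
      coefficient of that column and thus vanishes on the span of the earlier ones.\<close>
    define f where "f y = (\<Sum>i\<in>Q. b (h j) i * y i)" for y :: "nat \<Rightarrow> complex"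
    have f: "f \<in> polyfun {..<D}"
      unfolding f_def using Qb by (intro polyfun_sum pmult pvar pconst) auto
    have val: "f (col_comb D E C' z) = (\<Sum>c\<in>C'. if c = h j then z c else 0)" if C': "C' \<subseteq> C" for C' z
    proof -
      have "f (col_comb D E C' z) = (\<Sum>i\<in>Q. \<Sum>c\<in>C'. z c * (b (h j) i * E i c))"
        unfolding f_def col_comb_def using Qb
        by (intro sum.cong) (auto simp: sum_distrib_left mult_ac)
      also have "\<dots> = (\<Sum>c\<in>C'. z c * (\<Sum>i\<in>Q. b (h j) i * E i c))"
        by (subst sum.swap) (simp add: sum_distrib_left)
      also have "\<dots> = (\<Sum>c\<in>C'. if c = h j then z c else 0)"
        using Qb C' hj(1) by (intro sum.cong refl) auto
      finally show ?thesis .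
    qed
    have 0: "f (col_comb D E (Cs j) z) = 0" for z
      unfolding val[OF Cs[OF less_imp_le[OF j]]] using hj(2) by (intro sum.neutral) auto
    have 1: "f (col_comb D E (Cs (Suc j)) (\<lambda>_. 1)) = 1"
      unfolding val[OF Cs[OF Suc_leI[OF j]]] using hj fin by simp
    have "col_comb D E (Cs (Suc j)) (\<lambda>_. 1) \<in> T (Suc j)"
      unfolding T_def zariski_closure_eq[OF cs] using col_comb_in_cspace by blast
    moreover have "col_comb D E (Cs (Suc j)) (\<lambda>_. 1) \<notin> T j"
      unfolding T_def zariski_closure_eq[OF cs] using 0 1 f by force
    ultimately show "T j \<noteq> T (Suc j)" by blast
  qed
  show ?thesis unfolding alg_dim_def
    using irr Tsub strict by (intro Sup_upper) blast
qed

section \<open>The variety of edge lengths\<close>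

text \<open>The polarised squared length. With \<open>q = p\<close> it is the measurement of
  \<open>e\<close>; for general \<open>q\<close> it is half the derivative of that measurement in
  direction \<open>q\<close>, that is, a row of the rigidity matrix applied to
  \<open>q\<close>.\<close>

definition edge_form :: "nat \<Rightarrow> (nat \<Rightarrow> nat \<Rightarrow> complex) \<Rightarrow> (nat \<Rightarrow> nat \<Rightarrow> complex) \<Rightarrow> nat set \<Rightarrow> complex" where
  "edge_form d p q e = (\<Sum>k<d. (p (Min e) k - p (Max e) k) * (q (Min e) k - q (Max e) k))"

lemma finite_Kedges: "finite (Kedges n)"
proof -
  have "Kedges n \<subseteq> Pow {..<n}" by (auto simp: Kedges_def)
  then show ?thesis using finite_subset by blast
qed

lemma edge_form_line:
  "edge_form d (\<lambda>i k. p i k + t * q i k) q' e = edge_form d p q' e + t * edge_form d q q' e"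
  by (simp add: edge_form_def sum.distrib[symmetric] sum_distrib_left algebra_simps)

lemma edge_form_commute: "edge_form d p q e = edge_form d q p e"
  by (simp add: edge_form_def mult.commute)

text \<open>The derivative of \<open>l e\<close> in direction \<open>q\<close> is \<open>edge_form d p q e / l e\<close>, so the independence
  condition says that \<open>l \<mapsto> (\<lambda>c. \<Sum>e. A c e * l e)\<close>, restricted to the variety, is a submersion at \<open>l\<close>.\<close>

definition regular_point ::
  "nat \<Rightarrow> nat \<Rightarrow> 'c set \<Rightarrow> ('c \<Rightarrow> nat set \<Rightarrow> complex) \<Rightarrow> (nat \<Rightarrow> nat \<Rightarrow> complex) \<Rightarrow> (nat set \<Rightarrow> complex) \<Rightarrow> bool" where
  "regular_point d n C A p l \<longleftrightarrow>
     (\<forall>e\<in>Kedges n. l e \<noteq> 0 \<and> (l e)\<^sup>2 = edge_form d p p e) \<and>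
     indep_on C UNIV (\<lambda>c q. \<Sum>e\<in>Kedges n. A c e / l e * edge_form d p q e)"

text \<open>The straight motion \<open>p + t * q\<close> lifts to edge lengths by a local branch of
  the square root, and regularity persists for small \<open>t\<close> because independence is
  open.\<close>

lemma regular_point_curve:
  assumes C: "finite C" and reg: "regular_point d n C A p l"
  obtains \<gamma> where "\<And>e. e \<in> Kedges n \<Longrightarrow> \<gamma> 0 e = l e"
    "\<And>e. e \<in> Kedges n \<Longrightarrow> ((\<lambda>t. \<gamma> t e) has_field_derivative edge_form d p q e / l e) (at 0)"
    "eventually (\<lambda>t. regular_point d n C A (\<lambda>i k. p i k + t * q i k) (\<gamma> t)) (nhds 0)"
proof -
  define P where "P t = (\<lambda>i k. p i k + t * q i k)" for t
  define m where "m t e = edge_form d (P t) (P t) e" for t e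
  \<comment> \<open>Dividing by \<open>m 0 e\<close> keeps the radicand near \<open>1\<close>, where
    the principal root is holomorphic; the factor \<open>l e\<close> selects the prescribed
    sign.\<close>
  define \<gamma> where "\<gamma> t e = l e * csqrt (m t e / m 0 e)" for t e
  have m: "m t e = edge_form d p p e + 2 * t * edge_form d p q e + t\<^sup>2 * edge_form d q q e" for t e
    unfolding m_def P_def edge_form_line
    by (subst (1 2) edge_form_commute, unfold edge_form_line)
       (simp add: algebra_simps power2_eq_square edge_form_commute[of d q p])
  have l: "l e \<noteq> 0" "(l e)\<^sup>2 = m 0 e" if "e \<in> Kedges n" for e
    using reg that by (auto simp: regular_point_def m)
  have m0: "m 0 e \<noteq> 0" if "e \<in> Kedges n" for e
    using l(1)[OF that] by (simp add: l(2)[OF that, symmetric])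
  have 0: "\<gamma> 0 e = l e" if "e \<in> Kedges n" for e
    using m0[OF that] by (simp add: \<gamma>_def)
  have der: "((\<lambda>t. \<gamma> t e) has_field_derivative edge_form d p q e / l e) (at 0)" if e: "e \<in> Kedges n" for e
  proof -
    have "((\<lambda>t. m t e / m 0 e) has_field_derivative (2 * edge_form d p q e / m 0 e)) (at 0)"
      using m0[OF e] unfolding m by (auto intro!: derivative_eq_intros)
    moreover have "(csqrt has_field_derivative inverse (2 * csqrt 1)) (at (m 0 e / m 0 e))"
      using m0[OF e] has_field_derivative_csqrt[of 1] by simp
    ultimately have "((\<lambda>t. csqrt (m t e / m 0 e)) has_field_derivative
        inverse (2 * csqrt 1) * (2 * edge_form d p q e / m 0 e)) (at 0)"
      by (rule DERIV_chain2[rotated])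
    then have "((\<lambda>t. \<gamma> t e) has_field_derivative
        l e * (inverse (2 * csqrt 1) * (2 * edge_form d p q e / m 0 e))) (at 0)"
      unfolding \<gamma>_def by (rule DERIV_cmult)
    also have "l e * (inverse (2 * csqrt 1) * (2 * edge_form d p q e / m 0 e)) = edge_form d p q e / l e"
      using l[OF e] by (simp add: l(2)[OF e, symmetric] power2_eq_square)
    finally show ?thesis .
  qed
  have cont: "((\<lambda>t. \<gamma> t e) \<longlongrightarrow> l e) (nhds 0)" if "e \<in> Kedges n" for e
    using DERIV_isCont[OF der[OF that]] 0[OF that] tendsto_at_iff_tendsto_nhds[of "\<lambda>t. \<gamma> t e" 0]
    by (simp add: isCont_def)
  have "eventually (\<lambda>t. \<forall>e\<in>Kedges n. \<gamma> t e \<noteq> 0) (nhds 0)"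
    using cont l(1) by (intro eventually_ball_finite[OF finite_Kedges] ballI tendsto_imp_eventually_ne) auto
  moreover have "eventually (\<lambda>t. indep_on C UNIV
      (\<lambda>c q'. \<Sum>e\<in>Kedges n. A c e / \<gamma> t e * edge_form d (P t) q' e)) (nhds 0)"
  proof (rule eventually_indep_on[OF C])
    show "indep_on C UNIV (\<lambda>c q. \<Sum>e\<in>Kedges n. A c e / l e * edge_form d p q e)"
      using reg by (simp add: regular_point_def)
    have "((\<lambda>t. edge_form d p q' e + t * edge_form d q q' e) \<longlongrightarrow> edge_form d p q' e) (nhds 0)" for q' e
      by (rule tendsto_eq_intros filterlim_ident | simp)+
    then show "((\<lambda>t. \<Sum>e\<in>Kedges n. A c e / \<gamma> t e * edge_form d (P t) q' e) \<longlongrightarrow>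
       (\<Sum>e\<in>Kedges n. A c e / l e * edge_form d p q' e)) (nhds 0)" for c q'
      unfolding P_def edge_form_line
      using cont l(1) by (intro tendsto_sum tendsto_mult tendsto_divide tendsto_const) auto
  qed
  ultimately have "eventually (\<lambda>t. regular_point d n C A (P t) (\<gamma> t)) (nhds 0)"
  proof eventually_elim
    case (elim t)
    have "(\<gamma> t e)\<^sup>2 = m t e" if "e \<in> Kedges n" for e
      using l(2)[OF that] m0[OF that] by (simp add: \<gamma>_def power_mult_distrib)
    then show ?case using elim by (simp add: regular_point_def m_def)
  qed
  with 0 der show ?thesis unfolding P_def by (intro that[of \<gamma>]) auto
qed

text \<open>At a regular point the differential is onto, so a polynomial that vanishes on the images
  of all regular points has partial derivatives vanishing there as well. The Taylor argument then
  applies at a single such image.\<close>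

lemma polyfun_eq_0_if_vanishes_on_regular_points:
  fixes A :: "'c \<Rightarrow> nat set \<Rightarrow> complex"
  assumes C: "finite C" and h: "h \<in> polyfun C" and reg0: "regular_point d n C A p0 l0"
    and van: "\<And>p l. regular_point d n C A p l \<Longrightarrow> h (\<lambda>c. \<Sum>e\<in>Kedges n. A c e * l e) = 0"
  shows "h y = 0"
proof -
  define Y where "Y l = (\<lambda>c. \<Sum>e\<in>Kedges n. A c e * l e)" for l
  \<comment> \<open>Vanishing is demanded at every regular point, not only at \<open>l0\<close>:
    this makes the class closed under differentiation.\<close>
  define Z where "Z = {f \<in> polyfun C. \<forall>p l. regular_point d n C A p l \<longrightarrow> f (Y l) = 0}"
  show ?thesis
  proof (rule polyfun_eq_0_if_derivs_vanish[OF C, of h Z "Y l0"])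
    show "h \<in> Z" using h van by (simp add: Z_def Y_def)
    show "Z \<subseteq> polyfun C" by (auto simp: Z_def)
    show "f (Y l0) = 0" if "f \<in> Z" for f using that reg0 by (auto simp: Z_def)
    fix f G v assume f: "f \<in> Z" and G: "gradient_on C f G"
    have "G c (Y l) = 0" if reg: "regular_point d n C A p l" and c: "c \<in> C" for p l c
    \<comment> \<open>Along a lifted curve \<open>f\<close> is constantly zero; the chain rule turns
      this into a linear relation between the differentials, weighted by the partial derivatives of
      \<open>f\<close>.\<close>
    proof (rule indep_onD[where a = c and w = "\<lambda>c. G c (Y l)"])
      show "indep_on C UNIV (\<lambda>c q. \<Sum>e\<in>Kedges n. A c e / l e * edge_form d p q e)"
        using reg by (simp add: regular_point_def)
      fix q
      obtain \<gamma> where \<gamma>: "\<And>e. e \<in> Kedges n \<Longrightarrow> \<gamma> 0 e = l e"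
        "\<And>e. e \<in> Kedges n \<Longrightarrow> ((\<lambda>t. \<gamma> t e) has_field_derivative edge_form d p q e / l e) (at 0)"
        "eventually (\<lambda>t. regular_point d n C A (\<lambda>i k. p i k + t * q i k) (\<gamma> t)) (nhds 0)"
        using regular_point_curve[OF C reg, where q = q] by blast
      have Y0: "Y (\<gamma> 0) = Y l" using \<gamma>(1) by (auto simp: Y_def intro!: ext sum.cong)
      have "((\<lambda>t. Y (\<gamma> t) c) has_field_derivative
          (\<Sum>e\<in>Kedges n. A c e * (edge_form d p q e / l e))) (at 0)" for c
        unfolding Y_def using \<gamma>(2) by (intro DERIV_sum DERIV_cmult) auto
      from gradient_onD(2)[OF G this]
      have "((\<lambda>t. f (Y (\<gamma> t))) has_field_derivative
          (\<Sum>c\<in>C. (\<Sum>e\<in>Kedges n. A c e * (edge_form d p q e / l e)) * G c (Y l))) (at 0)"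
        by (simp add: Y0)
      moreover have "((\<lambda>t. f (Y (\<gamma> t))) has_field_derivative 0) (at 0)"
      proof -
        have "eventually (\<lambda>t. f (Y (\<gamma> t)) = 0) (nhds 0)"
          using \<gamma>(3) by eventually_elim (use f in \<open>auto simp: Z_def\<close>)
        then show ?thesis by (subst DERIV_cong_ev[OF refl _ refl, where g = "\<lambda>_. 0"]) auto
      qed
      ultimately have "(\<Sum>c\<in>C. (\<Sum>e\<in>Kedges n. A c e * (edge_form d p q e / l e)) * G c (Y l)) = 0"
        by (rule DERIV_unique)
      then show "(\<Sum>c\<in>C. G c (Y l) * (\<Sum>e\<in>Kedges n. A c e / l e * edge_form d p q e)) = 0"
        by (simp add: mult.commute)
    qed (rule c)
    moreover have "(\<lambda>y. \<Sum>i\<in>C. v i * G i y) \<in> polyfun C"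
      using gradient_onD(1)[OF G] by (intro polyfun_sum polyfun_cmult)
    ultimately show "(\<lambda>y. \<Sum>i\<in>C. v i * G i y) \<in> Z" by (auto simp: Z_def intro!: sum.neutral)
  qed
qed

section \<open>Density of the image in the column space\<close>

lemma mat_apply_in_cspace: "mat_apply D n E x \<in> cspace {..<D}"
  by (simp add: cspace_def mat_apply_def)

text \<open>Column \<open>e\<close> of \<open>A\<close> holds the coordinates of column
  \<open>e\<close> of \<open>E\<close> with respect to \<open>C\<close>, so \<open>E\<close> factors
  through coefficient space.\<close>

lemma mat_apply_eq_col_comb:
  assumes A: "\<And>i e. i < D \<Longrightarrow> e \<in> Kedges n \<Longrightarrow> E i e = (\<Sum>c\<in>C. A c e * E i c)"
  shows "mat_apply D n E x = col_comb D E C (\<lambda>c. \<Sum>e\<in>Kedges n. A c e * x e)"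
proof
  fix i
  have "(\<Sum>e\<in>Kedges n. E i e * x e) = (\<Sum>c\<in>C. (\<Sum>e\<in>Kedges n. A c e * x e) * E i c)" if "i < D"
  proof -
    have "(\<Sum>e\<in>Kedges n. E i e * x e) = (\<Sum>e\<in>Kedges n. \<Sum>c\<in>C. A c e * x e * E i c)"
    proof (intro sum.cong refl)
      fix e assume e: "e \<in> Kedges n"
      show "E i e * x e = (\<Sum>c\<in>C. A c e * x e * E i c)"
        unfolding A[OF that e] by (simp add: sum_distrib_left mult_ac)
    qed
    then show ?thesis by (subst (asm) sum.swap) (simp add: sum_distrib_right)
  qed
  then show "mat_apply D n E x i = col_comb D E C (\<lambda>c. \<Sum>e\<in>Kedges n. A c e * x e) i"
    by (simp add: mat_apply_def col_comb_def)
qed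

text \<open>A polynomial vanishing on the image pulls back to coefficient space, where it vanishes
  at all images of regular points and is therefore zero.\<close>

lemma range_col_comb_subset_closure:
  assumes C: "finite C" and reg: "regular_point d n C A p0 l0"
    and A: "\<And>i e. i < D \<Longrightarrow> e \<in> Kedges n \<Longrightarrow> E i e = (\<Sum>c\<in>C. A c e * E i c)"
  shows "range (col_comb D E C) \<subseteq> zariski_closure {..<D} (mat_apply D n E ` Ldn d n)"
proof -
  have S: "mat_apply D n E ` Ldn d n \<subseteq> cspace {..<D}" using mat_apply_in_cspace by blast
  have "f (col_comb D E C z) = 0"
    if f: "f \<in> polyfun {..<D}" and van: "\<And>s. s \<in> Ldn d n \<Longrightarrow> f (mat_apply D n E s) = 0" for f z
  proof (rule polyfun_eq_0_if_vanishes_on_regular_points[OF C _ reg, of "\<lambda>z. f (col_comb D E C z)"])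
    show "(\<lambda>z. f (col_comb D E C z)) \<in> polyfun C"
      using f col_comb_polyfun by (rule polyfun_compose)
    fix p l assume pl: "regular_point d n C A p l"
    define l' where "l' e = (if e \<in> Kedges n then l e else 0)" for e
    have "(\<lambda>e. (l' e)\<^sup>2) = meas d n p"
      using pl by (auto simp: l'_def meas_def regular_point_def edge_form_def power2_eq_square)
    then have "l' \<in> Ldn d n" by (auto simp: Ldn_def Mdn_def cspace_def l'_def)
    moreover have "(\<Sum>e\<in>Kedges n. A c e * l' e) = (\<Sum>e\<in>Kedges n. A c e * l e)" for c
      by (intro sum.cong) (auto simp: l'_def)
    then have "mat_apply D n E l' = col_comb D E C (\<lambda>c. \<Sum>e\<in>Kedges n. A c e * l e)"
      using mat_apply_eq_col_comb[OF A, where x = l'] by simp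
    ultimately show "f (col_comb D E C (\<lambda>c. \<Sum>e\<in>Kedges n. A c e * l e)) = 0"
      using van[of l'] by simp
  qed
  then have "col_comb D E C z \<in> zariski_closure {..<D} (mat_apply D n E ` Ldn d n)" for z
    unfolding zariski_closure_eq[OF S] by (simp add: col_comb_in_cspace)
  then show ?thesis by (rule image_subsetI)
qed

text \<open>On \<open>C\<close> the matrix \<open>A\<close> is the identity, so these edges alone
  give an independent family of differentials. Every other edge adds a rank-one term, and the sign
  of its length is still free to be chosen so that independence survives.\<close>

lemma ex_regular_point:
  assumes C: "C \<subseteq> Kedges n" and A: "\<And>c c'. c \<in> C \<Longrightarrow> c' \<in> C \<Longrightarrow> A c c' = (if c = c' then 1 else 0)"
    and p: "\<And>e. e \<in> Kedges n \<Longrightarrow> edge_form d p p e \<noteq> 0"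
    and ind: "indep_on C UNIV (\<lambda>c q. edge_form d p q c)"
  shows "\<exists>l. regular_point d n C A p l"
proof -
  define r where "r e = csqrt (edge_form d p p e)" for e
  have r: "r e \<noteq> 0" "(r e)\<^sup>2 = edge_form d p p e" if "e \<in> Kedges n" for e
    using p[OF that] by (auto simp: r_def)
  have finC: "finite C" using C finite_Kedges finite_subset by blast
  have "indep_on C UNIV (\<lambda>c q. edge_form d p q c / r c)"
    unfolding indep_on_def
  proof (intro allI impI ballI)
    fix w c assume "\<forall>q\<in>UNIV. (\<Sum>c\<in>C. w c * (edge_form d p q c / r c)) = 0" and c: "c \<in> C"
    then have "w c / r c = 0"
      \<comment> \<open>The nonzero factors \<open>1 / r c\<close> only rescale the coefficients of
        a relation.\<close>
      using indep_onD[OF ind, of "\<lambda>c. w c / r c" c] by simp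
    then show "w c = 0" using r c C by auto
  qed
  from indep_on_rank_one_signs[OF finite_Diff[OF finite_Kedges, of n C] this,
      of "\<lambda>e c. A c e" "\<lambda>e q. edge_form d p q e / r e"]
  obtain \<sigma> where \<sigma>: "\<And>e. \<sigma> e = 1 \<or> \<sigma> e = (-1::complex)"
    and ind': "indep_on C UNIV (\<lambda>c q. edge_form d p q c / r c +
      (\<Sum>e\<in>Kedges n - C. \<sigma> e * A c e * (edge_form d p q e / r e)))" by blast
  define l where "l e = (if e \<in> C then r e else \<sigma> e * r e)" for e
  have l: "l e \<noteq> 0 \<and> (l e)\<^sup>2 = edge_form d p p e" if "e \<in> Kedges n" for e
    using r[OF that] \<sigma>[of e] by (auto simp: l_def)
  have "(\<Sum>e\<in>Kedges n. A c e / l e * edge_form d p q e) =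
      edge_form d p q c / r c + (\<Sum>e\<in>Kedges n - C. \<sigma> e * A c e * (edge_form d p q e / r e))"
    if c: "c \<in> C" for c q
  proof -
    have "(\<Sum>e\<in>C. A c e / l e * edge_form d p q e) = (\<Sum>e\<in>C. if c = e then edge_form d p q e / r e else 0)"
      using A[OF c] by (intro sum.cong refl) (auto simp: l_def)
    also have "\<dots> = edge_form d p q c / r c" using finC c by simp
    finally have 1: "(\<Sum>e\<in>C. A c e / l e * edge_form d p q e) = edge_form d p q c / r c" .
    have 2: "(\<Sum>e\<in>Kedges n - C. A c e / l e * edge_form d p q e) =
      (\<Sum>e\<in>Kedges n - C. \<sigma> e * A c e * (edge_form d p q e / r e))"
    proof (intro sum.cong refl)
      fix e assume "e \<in> Kedges n - C"
      then show "A c e / l e * edge_form d p q e = \<sigma> e * A c e * (edge_form d p q e / r e)"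
        using \<sigma>[of e] by (auto simp: l_def)
    qed
    show ?thesis unfolding sum.subset_diff[OF C finite_Kedges] 1 2 by (rule add.commute)
  qed
  then have "indep_on C UNIV (\<lambda>c q. \<Sum>e\<in>Kedges n. A c e / l e * edge_form d p q e)"
    using ind' by (simp add: indep_on_def)
  then show ?thesis using l unfolding regular_point_def by blast
qed

lemma Kedges_eq: "Kedges n = {e. e \<subseteq> {..<n} \<and> card e = 2}"
proof (intro equalityI subsetI)
  fix e assume "e \<in> {e. e \<subseteq> {..<n} \<and> card e = 2}"
  then obtain i j where "e = {i, j}" "i \<noteq> j" "i < n" "j < n" by (auto simp: card_2_iff)
  then have "e = {min i j, max i j}" "min i j < max i j" "max i j < n"
    by (auto simp: min_def max_def)
  then show "e \<in> Kedges n" unfolding Kedges_def by blast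
qed (auto simp: Kedges_def)

lemma edge_form_pair:
  assumes "u \<noteq> v"
  shows "edge_form d p q {u, v} = (\<Sum>k<d. (p u k - p v k) * (q u k - q v k))"
proof (cases "u < v")
  case True
  then show ?thesis by (simp add: edge_form_def)
next
  case False
  then have "min u v = v" "max u v = u" using assms by auto
  then show ?thesis by (auto simp: edge_form_def algebra_simps intro!: sum.cong)
qed

section \<open>Stresses on the moment curve\<close>

text \<open>The point of index \<open>i\<close> is \<open>(i, i^2, ..., i^d)\<close> once only the
  coordinates \<open>k < d\<close> are used. Pairing differences of such points with coefficient
  vectors amounts to evaluating polynomials.\<close>

definition moment_curve :: "nat \<Rightarrow> nat \<Rightarrow> complex" where
  "moment_curve i k = of_nat i ^ Suc k"

text \<open>The points are real and differ in their first coordinate, so the sum of squares is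
  positive; isotropic edges cannot occur.\<close>

lemma edge_form_moment_curve_nonzero:
  assumes "d \<ge> 1" "e \<in> Kedges n"
  shows "edge_form d moment_curve moment_curve e \<noteq> 0"
proof -
  obtain i j where e: "e = {i, j}" "i < j" using assms by (auto simp: Kedges_def)
  define x where "x = (\<Sum>k<d. (real i ^ Suc k - real j ^ Suc k)\<^sup>2)"
  have "0 < (real i ^ Suc 0 - real j ^ Suc 0)\<^sup>2" using e by simp
  then have "x > 0"
    unfolding x_def using assms(1) by (intro sum_pos2[of "{..<d}" 0]) auto
  moreover have "edge_form d moment_curve moment_curve e = of_real x"
    using e by (simp add: edge_form_pair moment_curve_def x_def power2_eq_square)
  ultimately show ?thesis by simp
qed

lemma moment_curve_poly_diff:
  fixes f :: "complex poly"
  assumes "degree f \<le> d"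
  shows "(\<Sum>k<d. (moment_curve u k - moment_curve v k) * coeff f (Suc k)) = poly f (of_nat u) - poly f (of_nat v)"
proof -
  have "poly f x = (\<Sum>i\<le>d. coeff f i * x ^ i)" for x
    unfolding poly_altdef using assms
    by (intro sum.mono_neutral_left) (auto simp: coeff_eq_0)
  then have "poly f x = coeff f 0 + (\<Sum>k<d. coeff f (Suc k) * x ^ Suc k)" for x
    by (simp add: sum.atMost_shift)
  then show ?thesis
    by (simp add: moment_curve_def sum_subtractf[symmetric] algebra_simps)
qed

text \<open>With at most \<open>d\<close> stressed edges at \<open>v\<close>, some infinitesimal
  motion of \<open>v\<close> alone is orthogonal to all of them except \<open>c0\<close>. The
  equilibrium equation then forces \<open>w c0 = 0\<close>.\<close>

lemma stress_degree:
  assumes C: "C \<subseteq> Kedges n"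
    and w: "\<And>q. (\<Sum>c\<in>C. w c * edge_form d moment_curve q c) = 0"
    and c0: "c0 \<in> C" "w c0 \<noteq> 0" "v \<in> c0"
  shows "d + 1 \<le> card {u. {u, v} \<in> C \<and> w {u, v} \<noteq> 0}"
proof (rule ccontr)
  define N where "N = {u. {u, v} \<in> C \<and> w {u, v} \<noteq> 0}"
  assume "\<not> ?thesis"
  then have cardN: "card N \<le> d" by (simp add: N_def)
  have edge: "u \<noteq> v" "u < n" if "{u, v} \<in> C" for u
    using that C by (auto simp: Kedges_eq)
  have finN: "finite N" using edge by (intro finite_subset[of N "{..<n}"]) (auto simp: N_def)
  have finC: "finite C" using C finite_Kedges finite_subset by blast
  have other: "\<exists>u. c = {u, v}" if "c \<in> C" "v \<in> c" for c
    using that C by (auto simp: Kedges_eq card_2_iff)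
  obtain u0 where u0: "c0 = {u0, v}" using other c0 by blast
  then have u0N: "u0 \<in> N" using c0 by (simp add: N_def)
  \<comment> \<open>The roots are \<open>v\<close> and every stressed neighbour but
    \<open>u0\<close>, which makes the degree \<open>card N\<close>, at most \<open>d\<close>. The
    coefficients of \<open>f\<close> give the motion of \<open>v\<close>, and the root at
    \<open>v\<close> reduces the edge value at \<open>u\<close> to the value of \<open>f\<close> at
    \<open>u\<close>, up to sign.\<close>
  define f :: "complex poly" where "f = [:- of_nat v, 1:] * (\<Prod>u\<in>N - {u0}. [:- of_nat u, 1:])"
  have f0: "poly f (of_nat x) = 0 \<longleftrightarrow> x = v \<or> x \<in> N - {u0}" for x
    using finN by (auto simp: f_def poly_prod)
  have "degree f = 1 + card (N - {u0})"
    unfolding f_def by (subst degree_mult_eq) (use finN in \<open>auto simp: degree_prod_eq_sum_degree prod_zero_iff\<close>)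
  then have deg: "degree f \<le> d"
    using cardN u0N finN by (metis card_Suc_Diff1 plus_1_eq_Suc)
  define q where "q i k = (if i = v then coeff f (Suc k) else 0)" for i k
  have val: "edge_form d moment_curve q {u, v} = poly f (of_nat u) * (-1)" if "u \<noteq> v" for u
  proof -
    have "edge_form d moment_curve q {u, v} =
      - (\<Sum>k<d. (moment_curve u k - moment_curve v k) * coeff f (Suc k))"
      using that by (simp add: edge_form_pair q_def sum_negf[symmetric])
    then show ?thesis using moment_curve_poly_diff[OF deg, of u v] f0[of v] by simp
  qed
  have "w c * edge_form d moment_curve q c = 0" if c: "c \<in> C - {c0}" for c
  proof (cases "v \<in> c")
    case True
    then obtain u where u: "c = {u, v}" using other c by blast
    then have "w c = 0 \<or> u \<in> N - {u0}" using c u0 by (auto simp: N_def)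
    then show ?thesis using f0[of u] val[of u] edge[of u] u c by auto
  next
    case False
    obtain i j where "c = {i, j}" "i < j" using c C unfolding Kedges_def by blast
    then show ?thesis using False by (auto simp: edge_form_pair q_def)
  qed
  then have "(\<Sum>c\<in>C. w c * edge_form d moment_curve q c) = w c0 * edge_form d moment_curve q c0"
    by (subst sum.remove[OF finC c0(1)]) (simp add: sum.neutral del: mult_eq_0_iff)
  moreover have "u0 \<noteq> v" using edge c0 u0 by blast
  ultimately have "w c0 * poly f (of_nat u0) = 0" using w[of q] val[of u0] u0 by simp
  then show False using c0 f0[of u0] \<open>u0 \<noteq> v\<close> by simp
qed

text \<open>Count incidences in the support \<open>X\<close> of a stress: at least
  \<open>d + 2\<close> vertices, each of degree at least \<open>d + 1\<close>, need at least
  \<open>(d + 2) choose 2\<close> edges. The bound on \<open>card C\<close> forces equality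
  throughout.\<close>

lemma dependent_edges_complete:
  assumes C: "C \<subseteq> Kedges n" and card: "card C \<le> (d + 2) choose 2"
    and dep: "\<not> indep_on C UNIV (\<lambda>c q. edge_form d moment_curve q c)"
  shows "card C = (d + 2) choose 2 \<and>
    (\<exists>V\<subseteq>{..<n}. card V = d + 2 \<and> C = {e. e \<subseteq> V \<and> card e = 2})"
proof -
  obtain w a where w: "\<And>q. (\<Sum>c\<in>C. w c * edge_form d moment_curve q c) = 0" and a: "a \<in> C" "w a \<noteq> 0"
    using dep unfolding indep_on_def by blast
  define X where "X = {c \<in> C. w c \<noteq> 0}"
  define V where "V = \<Union>X"
  have finC: "finite C" using C finite_Kedges finite_subset by blast
  have X: "X \<subseteq> C" "finite X" using finC by (auto simp: X_def)
  have V: "V \<subseteq> {..<n}" using C by (auto simp: V_def X_def Kedges_eq)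
  then have finV: "finite V" using finite_subset by blast
  have N: "{u. {u, v} \<in> C \<and> w {u, v} \<noteq> 0} \<subseteq> V - {v}" for v
    using C by (auto simp: V_def X_def Kedges_eq)
  have deg: "d + 1 \<le> card {u. {u, v} \<in> C \<and> w {u, v} \<noteq> 0}" if "v \<in> V" for v
    using that stress_degree[OF C w] by (auto simp: V_def X_def)
  have degX: "d + 1 \<le> card {c \<in> X. v \<in> c}" if v: "v \<in> V" for v
  proof -
    let ?N = "{u. {u, v} \<in> C \<and> w {u, v} \<noteq> 0}"
    have "card ?N = card ((\<lambda>u. {u, v}) ` ?N)"
      by (intro card_image[symmetric]) (auto simp: inj_on_def doubleton_eq_iff)
    also have "\<dots> \<le> card {c \<in> X. v \<in> c}"
      using finC by (intro card_mono) (auto simp: X_def)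
    finally show ?thesis using deg[OF v] by simp
  qed
  have "card a = 2" using a C by (auto simp: Kedges_eq)
  then have "a \<noteq> {}" by auto
  then obtain v where v: "v \<in> V" using a by (auto simp: V_def X_def)
  \<comment> \<open>The stressed neighbours of \<open>v\<close> are themselves vertices of the
    support.\<close>
  have "d + 1 \<le> card (V - {v})"
    using deg[OF v] card_mono[OF finite_Diff[OF finV] N[of v]] by linarith
  then have cardV: "d + 2 \<le> card V" using v finV by simp
  have two: "2 * ((d + 2) choose 2) = (d + 2) * (d + 1)"
    by (simp add: choose_two)
  have "card {v \<in> V. v \<in> c} = 2" if "c \<in> X" for c
  proof -
    have "{v \<in> V. v \<in> c} = c" using that by (auto simp: V_def)
    then show ?thesis using that X C by (auto simp: Kedges_eq)
  qed
  \<comment> \<open>Handshake count: every edge of the support has both ends in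
    \<open>V\<close>.\<close>
  then have "(\<Sum>v\<in>V. card {c \<in> X. v \<in> c}) = 2 * card X"
    using sum_multicount_gen[OF finV X(2), of "\<lambda>v c. v \<in> c" "\<lambda>_. 2"] by simp
  moreover have "card V * (d + 1) \<le> (\<Sum>v\<in>V. card {c \<in> X. v \<in> c})"
    using sum_mono[of V "\<lambda>_. d + 1", OF degX] by simp
  ultimately have le: "card V * (d + 1) \<le> 2 * card X" by simp
  moreover have XC: "card X \<le> card C" using X finC by (intro card_mono) auto
  ultimately have "card V * (d + 1) \<le> (d + 2) * (d + 1)"
    using card two by linarith
  then have cV: "card V = d + 2" using cardV by (metis le_antisym mult_le_cancel2 add_gr_0 zero_less_one)
  have "(d + 2) * (d + 1) \<le> 2 * card X" using le unfolding cV .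
  then have cX: "card C \<le> card X" and cC: "card C = (d + 2) choose 2"
    using two card XC by (linarith, linarith)
  have "X = C" using X finC cX by (intro card_seteq) auto
  moreover have "C \<subseteq> {e. e \<subseteq> V \<and> card e = 2}"
    using C \<open>X = C\<close> by (auto simp: V_def Kedges_eq)
  then have "C = {e. e \<subseteq> V \<and> card e = 2}"
    using finV n_subsets[OF finV, of 2] cV cC by (intro card_seteq) auto
  then show ?thesis using V cV cC by blast
qed

section \<open>Full dimension when a column basis carries no stress\<close>

lemma alg_dim_image_eq_rank:
  assumes d: "d \<ge> 1" and C: "C \<subseteq> Kedges n" and ind: "indep_on C {..<D} (\<lambda>e i. E i e)"
    and max: "\<And>e. e \<in> Kedges n - C \<Longrightarrow> \<not> indep_on (insert e C) {..<D} (\<lambda>e i. E i e)"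
    and rigid: "indep_on C UNIV (\<lambda>c q. edge_form d moment_curve q c)"
  shows "alg_dim {..<D} (mat_apply D n E ` Ldn d n) = enat (card C)"
proof (rule antisym)
  have finC: "finite C" using C finite_Kedges finite_subset by blast
  \<comment> \<open>Coordinates of every column in the basis \<open>C\<close>. Those of a basis
    column are recorded explicitly as a unit vector, the form that \<open>ex_regular_point\<close>
    asks for.\<close>
  have "\<exists>\<alpha>. (\<forall>i\<in>{..<D}. E i e = (\<Sum>c\<in>C. \<alpha> c * E i c)) \<and> (e \<in> C \<longrightarrow> \<alpha> = (\<lambda>c. if c = e then 1 else 0))"
    if e: "e \<in> Kedges n" for e
  proof (cases "e \<in> C")
    case True
    have "(\<Sum>c\<in>C. (if c = e then 1 else 0) * E i c) = E i e" for i
      using True finC by (simp add: if_distrib[of "\<lambda>x. x * _"] cong: if_cong)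
    then show ?thesis by (intro exI[of _ "\<lambda>c. if c = e then 1 else 0"]) simp
  next
    case False
    then show ?thesis using indep_on_coefficients[OF finC ind max] e by blast
  qed
  then obtain \<alpha> where \<alpha>: "\<And>e i. e \<in> Kedges n \<Longrightarrow> i < D \<Longrightarrow> E i e = (\<Sum>c\<in>C. \<alpha> e c * E i c)"
    "\<And>e. e \<in> Kedges n \<Longrightarrow> e \<in> C \<Longrightarrow> \<alpha> e = (\<lambda>c. if c = e then 1 else 0)"
    by (metis lessThan_iff)
  define A where "A c e = \<alpha> e c" for c e
  have A: "E i e = (\<Sum>c\<in>C. A c e * E i c)" if "i < D" "e \<in> Kedges n" for i e
    unfolding A_def using \<alpha>(1) that by blast
  have "A c c' = (if c = c' then 1 else 0)" if "c \<in> C" "c' \<in> C" for c c'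
    using \<alpha>(2)[OF subsetD[OF C that(2)] that(2)] by (simp add: A_def)
  then have "\<exists>l. regular_point d n C A moment_curve l"
    by (rule ex_regular_point[OF C _ edge_form_moment_curve_nonzero[OF d] rigid])
  then obtain l where l: "regular_point d n C A moment_curve l" by blast
  have S: "mat_apply D n E ` Ldn d n \<subseteq> cspace {..<D}"
    using mat_apply_in_cspace by blast
  show "enat (card C) \<le> alg_dim {..<D} (mat_apply D n E ` Ldn d n)"
    by (rule card_le_alg_dim[OF finC ind range_col_comb_subset_closure[OF finC l A] S])
  have "mat_apply D n E ` Ldn d n \<subseteq> range (col_comb D E C)"
    using mat_apply_eq_col_comb[OF A] by auto
  then show "alg_dim {..<D} (mat_apply D n E ` Ldn d n) \<le> enat (card C)"
    by (intro alg_dim_le_card_parameters[where \<phi> = "col_comb D E C"] finC col_comb_polyfun S)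
qed

section \<open>Comparison of column bases by exchange\<close>

theorem theorem4p2:
  fixes d n r :: nat and E :: "nat \<Rightarrow> nat set \<Rightarrow> complex"
  assumes "d \<ge> 1" and "n \<ge> 2"
    and "mat_rank ((d + 2) choose 2) n E = r"
    and "alg_dim {..<(d + 2) choose 2} (mat_apply ((d + 2) choose 2) n E ` Ldn d n) \<noteq> enat r"
  shows "r = (d + 2) choose 2 \<and> has_K_support (d + 2) ((d + 2) choose 2) n E"
proof -
  define D where "D = (d + 2) choose 2"
  let ?F = "\<lambda>e i. E i e"
  have cols: "cols_independent D E C \<longleftrightarrow> indep_on C {..<D} ?F" for C
    by (auto simp: cols_independent_def indep_on_def)
  define R where "R = {card C | C. C \<subseteq> Kedges n \<and> indep_on C {..<D} ?F}"
  have r: "r = Max R" using assms(3) unfolding R_def mat_rank_def D_def[symmetric] cols by simp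
  have "R \<subseteq> card ` Pow (Kedges n)" by (auto simp: R_def)
  then have finR: "finite R" using finite_Kedges finite_subset by blast
  have "0 \<in> R" unfolding R_def by (auto simp: indep_on_def intro!: exI[of _ "{}"])
  then have "r \<in> R" using finR r Max_in by blast
  then obtain C where C: "C \<subseteq> Kedges n" "indep_on C {..<D} ?F" "card C = r" by (auto simp: R_def)
  have fin: "finite C'" if "C' \<subseteq> Kedges n" for C'
    using that finite_Kedges finite_subset by blast
  have le_r: "card C' \<le> r" if "C' \<subseteq> Kedges n" "indep_on C' {..<D} ?F" for C'
    using that finR unfolding r by (intro Max_ge) (auto simp: R_def)
  have max: "\<not> indep_on (insert e C') {..<D} ?F"
    if "C' \<subseteq> Kedges n" "card C' = r" "e \<in> Kedges n - C'" for e C'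
    using le_r[of "insert e C'"] that fin[of C'] by auto
  have rD: "r \<le> D"
    using not_indep_on_if_card_less[of "{..<D}" C ?F] fin C by (auto simp: not_less[symmetric])
  \<comment> \<open>Stated for every column basis, since it is applied both to \<open>C\<close> and
    to the basis obtained from it by an exchange.\<close>
  have basis: "r = D \<and> (\<exists>V\<subseteq>{..<n}. card V = d + 2 \<and> C' = {e. e \<subseteq> V \<and> card e = 2})"
    if C': "C' \<subseteq> Kedges n" "indep_on C' {..<D} ?F" "card C' = r" for C'
  proof -
    have "\<not> indep_on C' UNIV (\<lambda>c q. edge_form d moment_curve q c)"
      using alg_dim_image_eq_rank[OF assms(1) C'(1,2) max[OF C'(1,3)]] assms(4) C'(3)
      by (auto simp: D_def)
    then show ?thesis
      using dependent_edges_complete[OF C'(1), of d] C'(3) rD by (simp add: D_def)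
  qed
  obtain V where V: "V \<subseteq> {..<n}" "card V = d + 2" "C = {e. e \<subseteq> V \<and> card e = 2}"
    using basis[OF C] by blast
  \<comment> \<open>A nonzero column outside the complete graph on \<open>V\<close> could replace
    some column of \<open>C\<close>, giving a second basis that is again a complete graph on
    \<open>d + 2\<close> vertices.\<close>
  have "E i e = 0" if e: "e \<in> Kedges n" "\<not> e \<subseteq> V" and i: "i < D" for e i
  proof (rule ccontr)
    assume "E i e \<noteq> 0"
    have eC: "e \<notin> C" using e V by auto
    obtain \<alpha> where \<alpha>: "\<And>s. s \<in> {..<D} \<Longrightarrow> E s e = (\<Sum>c\<in>C. \<alpha> c * E s c)"
      using indep_on_coefficients[OF fin[OF C(1)] C(2) max[OF C(1,3)]] e eC by blast
    have "\<exists>c0\<in>C. \<alpha> c0 \<noteq> 0"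
    proof (rule ccontr)
      assume "\<not> ?thesis"
      then have "E i e = 0" using \<alpha>[of i] i by simp
      then show False using \<open>E i e \<noteq> 0\<close> by simp
    qed
    then obtain c0 where c0: "c0 \<in> C" "\<alpha> c0 \<noteq> 0" by blast
    let ?C = "insert e (C - {c0})"
    have "indep_on ?C {..<D} ?F"
      using \<alpha> by (rule indep_on_exchange[where F = ?F and \<alpha> = \<alpha>, OF fin[OF C(1)] C(2) eC c0])
    moreover have "card ?C = r"
      using C(3) c0 eC fin[OF C(1)] card_Suc_Diff1[OF fin[OF C(1)] c0(1)] by simp
    moreover have "?C \<subseteq> Kedges n" using e(1) C(1) by blast
    ultimately have "\<exists>V\<subseteq>{..<n}. card V = d + 2 \<and> ?C = {e. e \<subseteq> V \<and> card e = 2}"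
      by (intro conjunct2[OF basis])
    then obtain V' where V': "V' \<subseteq> {..<n}" "card V' = d + 2" "?C = {e. e \<subseteq> V' \<and> card e = 2}"
      by (elim bexE exE conjE) (rule that)
    \<comment> \<open>The new graph contains \<open>e\<close>, hence \<open>v\<close>, and as
      \<open>d + 2 > 2\<close> it has a vertex \<open>x\<close> off \<open>e\<close>. Its edge
      \<open>{v, x}\<close> differs from \<open>e\<close>, so it already lies in \<open>C\<close>,
      although \<open>v\<close> is not in \<open>V\<close>.\<close>
    obtain v where v: "v \<in> e" "v \<notin> V" using e by blast
    have eV': "e \<subseteq> V'" "card e = 2" using V'(3) by blast+
    have "\<not> V' \<subseteq> e"
    proof
      assume "V' \<subseteq> e"
      then have "card V' \<le> 2" using eV' by (metis card_mono card.infinite zero_neq_numeral)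
      then show False using V'(2) assms(1) by simp
    qed
    then obtain x where x: "x \<in> V'" "x \<notin> e" by blast
    then have "{v, x} \<in> {e. e \<subseteq> V' \<and> card e = 2}" using v eV' by (auto simp: card_2_iff)
    then have "{v, x} \<in> C" using x unfolding V'(3)[symmetric] by auto
    then show False using V(3) v by auto
  qed
  then have "has_K_support (d + 2) D n E" using V unfolding has_K_support_def by blast
  then show ?thesis using basis[OF C] by (simp add: D_def)
qed

end
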